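(* Let $\mathcal{Z}=\mathcal{X}\times\mathcal{Y}$ be a compact metric space with metric $d_{\mathcal{Z}}$ (inducing the product topology), where $\mathcal{Y}\subset\mathbb{R}$ is closed. Let $L:\mathcal{X}\times\mathcal{Y}\times\mathbb{R}\to[0,\infty)$ be continuous, convex with respect to its third argument, and uniformly Lipschitz continuous with respect to its third argument with uniform Lipschitz constant $|L|_1\in(0,\infty)$, i.e. $|L|_1$ is the smallest constant $c$ such that $\sup_{(x,y)\in\mathcal{X}\times\mathcal{Y}}|L(x,y,t)-L(x,y,t')|\le c|t-t'|$ for all $t,t'\in\mathbb{R}$. Let $L^\star(x,y,t):=L(x,y,t)-L(x,y,0)$. Let $k:\mathcal{X}\times\mathcal{X}\to\mathbb{R}$ be a continuous kernel with reproducing kernel Hilbert space $H$ and $\|k\|_\infty:=(\sup_{x\in\mathcal{X}}k(x,x))^{1/2}\in(0,\infty)$. Let $\lambda\in(0,\infty)$. For Borel probability measures $P$ on $\mathcal{Z}$ define the SVM operator $$S(P):=f_{L^\star,P,\lambda}:=\arg\min_{f\in H}\ \mathbb{E}_P L^\star(X,Y,f(X))+\lambda\|f\|_H^2\in H$$ and the SVM risk functional $$R(P):=\mathbb{E}_P L^\star(X,Y,f_{L^\star,P,\lambda}(X))\in\mathbb{R},$$ where $(X,Y)$ has distribution $P$. Then: (i) The sequence $\mathfrak{L}_n(S;P_n)$, $n\in\mathbb{N}$, of bootstrap SVM estimators of $\mathfrak{L}_n(S;P)$ is qualitatively robust at every Borel probability measure $P$ on $\mathcal{Z}$. (ii) The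 sequence $\mathfrak{L}_n(R;P_n)$, $n\in\mathbb{N}$, of bootstrap SVM risk estimators of $\mathfrak{L}_n(R;P)$ is qualitatively robust at every Borel probability measure $P$ on $\mathcal{Z}$.
   Context: Under the stated assumptions the minimizer $f_{L^\star,P,\lambda}\in H$ exists and is unique and $R(P)$ is a well-defined real number for every Borel probability measure $P$ on $\mathcal{Z}$ (known fact). A kernel is a symmetric positive semidefinite function. Let $\mathcal{M}_1(\mathcal{Z})$ be the set of Borel probability measures on $\mathcal{Z}$. Bounded Lipschitz metric: for a metric space $(\mathcal{S},d)$ and $f:\mathcal{S}\to\mathbb{R}$ let $\|f\|_{\mathrm{BL}}:=\sup_{x}|f(x)|+\sup_{x\neq y}\frac{|f(x)-f(y)|}{d(x,y)}$. For Borel probability measures $\nu,\nu'$ on $\mathcal{S}$, $d_{\mathrm{BL}}(\nu,\nu'):=\sup_{\|f\|_{\mathrm{BL}}\le 1}\bigl|\int f\,d\nu-\int f\,d\nu'\bigr|$. Let $T:\mathcal{M}_1(\mathcal{Z})\to\mathcal{W}$ be a map into a complete separable metric space $(\mathcal{W},d_{\mathcal{W}})$; here $T=S$ with $\mathcal{W}=H$ (norm metric), or $T=R$ with $\mathcal{W}=\mathbb{R}$. The metric $d_{\mathrm{BL}}$ is used on $\mathcal{M}_1(\mathcal{Z})$, on the set $\mathcal{M}_1(\mathcal{W})$ of Borel probability measures on $\mathcal{W}$, and on the set of Borel probability measures on the metric space $(\mathcal{M}_1(\mathcal{W}),d_{\mathrm{BL}})$. For $P\in\mathcal{M}_1(\mathcal{Z})$,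 $\mathfrak{L}_n(T;P)\in\mathcal{M}_1(\mathcal{W})$ denotes the distribution of $T\bigl(\frac1n\sum_{i=1}^n\delta_{Z_i}\bigr)$ when $Z_1,\ldots,Z_n$ are i.i.d. with distribution $P$. For $Q\in\mathcal{M}_1(\mathcal{Z})$ let $Q_n:=\frac1n\sum_{i=1}^n\delta_{Z_i}$ be the (random) empirical measure of $Z_1,\ldots,Z_n$ i.i.d. with distribution $Q$. Then the bootstrap approximation $\mathfrak{L}_n(T;Q_n)$ is a random variable with values in $\mathcal{M}_1(\mathcal{W})$, and $\mathfrak{L}(\mathfrak{L}_n(T;Q_n))$ denotes its distribution, a Borel probability measure on $\mathcal{M}_1(\mathcal{W})$. The sequence $\mathfrak{L}_n(T;P_n)$ is qualitatively robust at $P\in\mathcal{M}_1(\mathcal{Z})$ if for every $\varepsilon>0$ there exist $\delta>0$ and $n_0\in\mathbb{N}$ such that for all $Q\in\mathcal{M}_1(\mathcal{Z})$: $d_{\mathrm{BL}}(Q,P)<\delta$ implies $\sup_{n\ge n_0} d_{\mathrm{BL}}\bigl(\mathfrak{L}(\mathfrak{L}_n(T;Q_n)),\mathfrak{L}(\mathfrak{L}_n(T;P_n))\bigr)<\varepsilon$. *)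

theory Defs
  imports "HOL-Probability.Probability"
begin

section \<open>Borel probability measures and the bounded Lipschitz metric\<close>

text \<open>
  Metric spaces are given by a carrier and a distance function (as in the library locale
  \<^locale>\<open>Metric_space\<close>) because the constructions below are iterated: the Borel probability
  measures on a metric space form, with the bounded Lipschitz metric, again a metric space, whose
  elements have type \<open>'a measure\<close>.
\<close>

definition metric_borel :: "'a set \<Rightarrow> ('a \<Rightarrow> 'a \<Rightarrow> real) \<Rightarrow> 'a measure" where
  "metric_borel M d = sigma M {U. openin (Metric_space.mtopology M d) U}"

lemma space_metric_borel: "space (metric_borel M d) = M"
  by (simp add: metric_borel_def space_measure_of_conv)

definition borel_probs :: "'a set \<Rightarrow> ('a \<Rightarrow> 'a \<Rightarrow> real) \<Rightarrow> 'a measure set" where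
  "borel_probs M d = {P. prob_space P \<and> sets P = sets (metric_borel M d)}"

text \<open>The norm takes values in \<^typ>\<open>ennreal\<close>, so that it is infinite for functions that are
  unbounded or not Lipschitz; only the values of \<open>f\<close> on \<open>M\<close> matter. On probability measures the
  supremum in the distance is at most 2; taking it in \<^typ>\<open>ennreal\<close> makes the
  distance nonnegative on the whole type, as \<^locale>\<open>Metric_space\<close> requires.\<close>

definition bl_norm :: "'a set \<Rightarrow> ('a \<Rightarrow> 'a \<Rightarrow> real) \<Rightarrow> ('a \<Rightarrow> real) \<Rightarrow> ennreal" where
  "bl_norm M d f = (SUP x\<in>M. ennreal \<bar>f x\<bar>)
     + (SUP (x, y)\<in>{(x, y). x \<in> M \<and> y \<in> M \<and> x \<noteq> y}. ennreal (\<bar>f x - f y\<bar> / d x y))"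

definition bl_dist ::
  "'a set \<Rightarrow> ('a \<Rightarrow> 'a \<Rightarrow> real) \<Rightarrow> 'a measure \<Rightarrow> 'a measure \<Rightarrow> real" where
  "bl_dist M d \<mu> \<nu> =
     enn2real (SUP f\<in>{f. bl_norm M d f \<le> 1}. ennreal \<bar>integral\<^sup>L \<mu> f - integral\<^sup>L \<nu> f\<bar>)"


section \<open>Empirical measures, sampling distributions and the bootstrap\<close>

definition emp_measure ::
  "'z set \<Rightarrow> ('z \<Rightarrow> 'z \<Rightarrow> real) \<Rightarrow> nat \<Rightarrow> (nat \<Rightarrow> 'z) \<Rightarrow> 'z measure" where
  "emp_measure Z dZ n z =
     measure_of Z (sets (metric_borel Z dZ)) (\<lambda>A. (\<Sum>i<n. indicator A (z i)) / of_nat n)"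

lemma sets_emp_measure: "sets (emp_measure Z dZ n z) = sets (metric_borel Z dZ)"
  unfolding emp_measure_def
  by (metis sets.sigma_sets_eq sets.space_closed sets_measure_of space_metric_borel)

lemma emeasure_emp_measure:
  assumes A: "A \<in> sets (metric_borel Z dZ)"
  shows "emeasure (emp_measure Z dZ n z) A = (\<Sum>i<n. indicator A (z i)) / of_nat n"
proof (rule emeasure_measure_of[OF emp_measure_def])
  show "sets (metric_borel Z dZ) \<subseteq> Pow Z"
    using sets.space_closed[of "metric_borel Z dZ"] by (simp add: space_metric_borel)
  show "A \<in> sets (emp_measure Z dZ n z)"
    using A by (simp add: sets_emp_measure)
  show "positive (sets (emp_measure Z dZ n z)) (\<lambda>A. (\<Sum>i<n. indicator A (z i)) / of_nat n)"
    by (auto simp: positive_def)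
  show "countably_additive (sets (emp_measure Z dZ n z))
          (\<lambda>A. (\<Sum>i<n. indicator A (z i)) / of_nat n)"
    unfolding countably_additive_def
    by (auto simp: divide_ennreal_def suminf_sum suminf_indicator intro!: sum.cong)
qed

lemma emp_measure_in_borel_probs:
  assumes "0 < n" "\<And>i. i < n \<Longrightarrow> z i \<in> Z"
  shows "emp_measure Z dZ n z \<in> borel_probs Z dZ"
proof -
  have sp: "space (emp_measure Z dZ n z) = Z"
    using sets_eq_imp_space_eq[OF sets_emp_measure] by (simp add: space_metric_borel)
  have "emeasure (emp_measure Z dZ n z) Z = (\<Sum>i<n. indicator Z (z i)) / of_nat n"
    using emeasure_emp_measure sets.top[of "metric_borel Z dZ"] by (metis space_metric_borel)
  also have "\<dots> = 1"
    using assms by (simp add: ennreal_divide_self of_nat_less_top less_imp_neq)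
  finally show ?thesis
    by (auto simp: borel_probs_def sp sets_emp_measure intro!: prob_spaceI)
qed

text \<open>\<open>stat_law Z dZ W dW T n P\<close> is the distribution of \<open>T\<close> evaluated at the empirical measure of
  \<open>n\<close> i.i.d. observations from \<open>P\<close>. The i.i.d. sample is realised as the coordinates of the
  \<open>n\<close>-fold product space.\<close>

definition stat_law ::
  "'z set \<Rightarrow> ('z \<Rightarrow> 'z \<Rightarrow> real) \<Rightarrow> 'w set \<Rightarrow> ('w \<Rightarrow> 'w \<Rightarrow> real) \<Rightarrow>
   ('z measure \<Rightarrow> 'w) \<Rightarrow> nat \<Rightarrow> 'z measure \<Rightarrow> 'w measure" where
  "stat_law Z dZ W dW T n P =
     distr (Pi\<^sub>M {..<n} (\<lambda>_. P)) (metric_borel W dW) (\<lambda>z. T (emp_measure Z dZ n z))"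

text \<open>The distribution of the bootstrap approximation: the outer sample, drawn from \<open>Q\<close>, produces
  the random empirical measure at which \<open>stat_law\<close> is evaluated.\<close>

definition bootstrap_law ::
  "'z set \<Rightarrow> ('z \<Rightarrow> 'z \<Rightarrow> real) \<Rightarrow> 'w set \<Rightarrow> ('w \<Rightarrow> 'w \<Rightarrow> real) \<Rightarrow>
   ('z measure \<Rightarrow> 'w) \<Rightarrow> nat \<Rightarrow> 'z measure \<Rightarrow> 'w measure measure" where
  "bootstrap_law Z dZ W dW T n Q =
     distr (Pi\<^sub>M {..<n} (\<lambda>_. Q)) (metric_borel (borel_probs W dW) (bl_dist W dW))
       (\<lambda>z. stat_law Z dZ W dW T n (emp_measure Z dZ n z))"

definition bootstrap_qualitatively_robust_at ::
  "'z set \<Rightarrow> ('z \<Rightarrow> 'z \<Rightarrow> real) \<Rightarrow> 'w set \<Rightarrow> ('w \<Rightarrow> 'w \<Rightarrow> real) \<Rightarrow>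
   ('z measure \<Rightarrow> 'w) \<Rightarrow> 'z measure \<Rightarrow> bool" where
  "bootstrap_qualitatively_robust_at Z dZ W dW T P \<longleftrightarrow>
     (\<forall>\<epsilon>>0. \<exists>\<delta>>0. \<exists>n0\<ge>1. \<forall>Q\<in>borel_probs Z dZ.
        bl_dist Z dZ Q P < \<delta> \<longrightarrow>
        (SUP n\<in>{n0..}. bl_dist (borel_probs W dW) (bl_dist W dW)
           (bootstrap_law Z dZ W dW T n Q) (bootstrap_law Z dZ W dW T n P)) < \<epsilon>)"


section \<open>Kernels and reproducing kernel Hilbert spaces\<close>

definition is_kernel :: "'x set \<Rightarrow> ('x \<Rightarrow> 'x \<Rightarrow> real) \<Rightarrow> bool" where
  "is_kernel X k \<longleftrightarrow>
     (\<forall>x\<in>X. \<forall>y\<in>X. k x y = k y x) \<and>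
     (\<forall>(n::nat) (a :: nat \<Rightarrow> real) x. (\<forall>i<n. x i \<in> X) \<longrightarrow>
        0 \<le> (\<Sum>i<n. \<Sum>j<n. a i * a j * k (x i) (x j)))"

text \<open>Functions on \<open>X\<close> are represented by elements of \<^term>\<open>extensional X\<close>, so that equality of
  representatives is equality on \<open>X\<close>. \<^locale>\<open>Metric_space\<close> asks for nonnegativity and symmetry
  also outside the carrier, where \<open>ip\<close> is arbitrary; hence the value 0 there.\<close>

definition ip_dist ::
  "'x set \<Rightarrow> ('x \<Rightarrow> real) set \<Rightarrow> (('x \<Rightarrow> real) \<Rightarrow> ('x \<Rightarrow> real) \<Rightarrow> real) \<Rightarrow>
   ('x \<Rightarrow> real) \<Rightarrow> ('x \<Rightarrow> real) \<Rightarrow> real" where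
  "ip_dist X H ip f g =
     (if f \<in> H \<and> g \<in> H then sqrt (ip (\<lambda>x\<in>X. f x - g x) (\<lambda>x\<in>X. f x - g x)) else 0)"

definition hilbert_function_space ::
  "'x set \<Rightarrow> ('x \<Rightarrow> real) set \<Rightarrow> (('x \<Rightarrow> real) \<Rightarrow> ('x \<Rightarrow> real) \<Rightarrow> real) \<Rightarrow> bool" where
  "hilbert_function_space X H ip \<longleftrightarrow>
     H \<subseteq> extensional X \<and>
     (\<lambda>x\<in>X. 0) \<in> H \<and>
     (\<forall>f\<in>H. \<forall>g\<in>H. (\<lambda>x\<in>X. f x + g x) \<in> H) \<and>
     (\<forall>c. \<forall>f\<in>H. (\<lambda>x\<in>X. c * f x) \<in> H) \<and>
     (\<forall>f\<in>H. \<forall>g\<in>H. ip f g = ip g f) \<and>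
     (\<forall>f\<in>H. \<forall>g\<in>H. \<forall>h\<in>H. ip (\<lambda>x\<in>X. f x + g x) h = ip f h + ip g h) \<and>
     (\<forall>c. \<forall>f\<in>H. \<forall>g\<in>H. ip (\<lambda>x\<in>X. c * f x) g = c * ip f g) \<and>
     (\<forall>f\<in>H. 0 \<le> ip f f) \<and>
     (\<forall>f\<in>H. ip f f = 0 \<longrightarrow> f = (\<lambda>x\<in>X. 0)) \<and>
     Metric_space.mcomplete H (ip_dist X H ip)"

definition is_rkhs ::
  "'x set \<Rightarrow> ('x \<Rightarrow> 'x \<Rightarrow> real) \<Rightarrow> ('x \<Rightarrow> real) set \<Rightarrow>
   (('x \<Rightarrow> real) \<Rightarrow> ('x \<Rightarrow> real) \<Rightarrow> real) \<Rightarrow> bool" where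
  "is_rkhs X k H ip \<longleftrightarrow>
     hilbert_function_space X H ip \<and>
     (\<forall>x\<in>X. (\<lambda>u\<in>X. k u x) \<in> H) \<and>
     (\<forall>x\<in>X. \<forall>f\<in>H. f x = ip f (\<lambda>u\<in>X. k u x))"


section \<open>Losses, the SVM operator and the SVM risk functional\<close>

definition is_uniform_lipschitz_const ::
  "'x set \<Rightarrow> real set \<Rightarrow> ('x \<Rightarrow> real \<Rightarrow> real \<Rightarrow> real) \<Rightarrow> real \<Rightarrow> bool" where
  "is_uniform_lipschitz_const X Y L c \<longleftrightarrow>
     (\<forall>x\<in>X. \<forall>y\<in>Y. c-lipschitz_on UNIV (L x y)) \<and>
     (\<forall>c'. (\<forall>x\<in>X. \<forall>y\<in>Y. c'-lipschitz_on UNIV (L x y)) \<longrightarrow> c \<le> c')"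

definition shifted_loss ::
  "('x \<Rightarrow> real \<Rightarrow> real \<Rightarrow> real) \<Rightarrow> 'x \<Rightarrow> real \<Rightarrow> real \<Rightarrow> real" where
  "shifted_loss L x y t = L x y t - L x y 0"

definition shifted_risk ::
  "('x \<Rightarrow> real \<Rightarrow> real \<Rightarrow> real) \<Rightarrow> ('x \<times> real) measure \<Rightarrow> ('x \<Rightarrow> real) \<Rightarrow> real" where
  "shifted_risk L P f = (\<integral>(x, y). shifted_loss L x y (f x) \<partial>P)"

text \<open>The squared norm of \<open>f\<close> in \<open>H\<close> is \<open>ip f f\<close>. The operator \<^const>\<open>arg_min_on\<close> picks some
  minimizer; under the assumptions on loss and kernel it exists and is unique.\<close>

definition svm ::
  "('x \<Rightarrow> real \<Rightarrow> real \<Rightarrow> real) \<Rightarrow> ('x \<Rightarrow> real) set \<Rightarrow>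
   (('x \<Rightarrow> real) \<Rightarrow> ('x \<Rightarrow> real) \<Rightarrow> real) \<Rightarrow> real \<Rightarrow> ('x \<times> real) measure \<Rightarrow> ('x \<Rightarrow> real)" where
  "svm L H ip reg P = arg_min_on (\<lambda>f. shifted_risk L P f + reg * ip f f) H"

definition svm_risk ::
  "('x \<Rightarrow> real \<Rightarrow> real \<Rightarrow> real) \<Rightarrow> ('x \<Rightarrow> real) set \<Rightarrow>
   (('x \<Rightarrow> real) \<Rightarrow> ('x \<Rightarrow> real) \<Rightarrow> real) \<Rightarrow> real \<Rightarrow> ('x \<times> real) measure \<Rightarrow> real" where
  "svm_risk L H ip reg P = shifted_risk L P (svm L H ip reg P)"

end

theory Submission
  imports Defs
begin

text \<open>
  Both functionals are uniformly continuous for the bounded Lipschitz distance: the regularized risk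
  is strongly convex, so the squared distance of two SVM solutions is bounded by the difference of
  the expectations, under the two measures, of loss functions that range over a uniformly bounded
  and equicontinuous family. Since the underlying space is totally bounded, empirical measures
  converge to the sampled measure \<open>Q\<close> at a rate that does not depend on \<open>Q\<close>. Hence, for large
  \<open>n\<close>, the law of \<open>T\<close> at the empirical measure is uniformly close to the Dirac measure at \<open>T Q\<close>.
  The same argument applied to the sampling law itself shows that the bootstrap law is uniformly
  close to the Dirac measure at the Dirac measure at \<open>T Q\<close>, which depends continuously on \<open>Q\<close>.
\<close>

section \<open>Bounded Lipschitz distance\<close>

context Metric_space
begin

text \<open>The bootstrap law is itself a sampling law: its statistic sends a measure to the law of
  \<open>T\<close> at \<open>n\<close> resampled points and takes values in
  \<open>borel_probs W dW\<close>. This statistic depends on \<open>n\<close>, so the concentration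
  step is stated for a sequence \<open>G n\<close> with limit \<open>G0\<close>, in a form
  (\<open>asymp_equicont\<close>) that its conclusion reproduces one level up. Uniformity in the
  sampled measure matters because at the outer level the measure resampled from is random. The main
  obstacle is measurability: \<open>distr\<close> is the image measure only along a measurable map,
  and here maps go from \<open>n\<close>-tuples into a space of measures with the Borel sets of
  \<open>bl_dist\<close>. It is obtained from uniform continuity in the sample points
  (\<open>sample_unif_cont\<close>), a second property that has to pass from a statistic to its
  sampling law. Total boundedness thus enters twice: in the finite partition that controls
  \<open>bl_dist\<close>, and in writing open sets of tuples as countable unions of boxes.\<close>

lemma sets_metric_borel: "sets (metric_borel M d) = sigma_sets M {U. openin mtopology U}"
  unfolding metric_borel_def
  by (rule sets_measure_of) (use openin_subset in force)

lemma openin_imp_sets_metric_borel: "openin mtopology U \<Longrightarrow> U \<in> sets (metric_borel M d)"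
  by (simp add: sets_metric_borel)

lemma mball_in_sets_metric_borel [measurable]: "mball x r \<in> sets (metric_borel M d)"
  by (simp add: openin_imp_sets_metric_borel)

lemma borel_measurable_metric_borelI:
  fixes f :: "'a \<Rightarrow> real"
  assumes "\<And>x e. x \<in> M \<Longrightarrow> 0 < e \<Longrightarrow> \<exists>\<delta>>0. \<forall>y\<in>M. d x y < \<delta> \<longrightarrow> \<bar>f x - f y\<bar> < e"
  shows "f \<in> borel_measurable (metric_borel M d)"
proof (rule borel_measurableI)
  fix S :: "real set"
  assume S: "open S"
  have "openin mtopology (f -` S \<inter> M)"
    unfolding openin_mtopology
  proof (intro conjI allI impI)
    fix x assume x: "x \<in> f -` S \<inter> M"
    then obtain e where e: "e > 0" "\<And>y. dist y (f x) < e \<Longrightarrow> y \<in> S"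
      using S unfolding open_dist by fastforce
    obtain \<delta> where \<delta>: "\<delta> > 0" "\<And>y. y \<in> M \<Longrightarrow> d x y < \<delta> \<Longrightarrow> \<bar>f x - f y\<bar> < e"
      using assms[of x e] x e(1) by auto
    then show "\<exists>r>0. mball x r \<subseteq> f -` S \<inter> M"
      by (intro exI[of _ \<delta>]) (auto intro!: e simp: dist_real_def abs_minus_commute)
  qed auto
  then show "f -` S \<inter> space (metric_borel M d) \<in> sets (metric_borel M d)"
    by (simp add: openin_imp_sets_metric_borel space_metric_borel)
qed

lemma borel_measurable_metric_borel_lipschitz:
  fixes f :: "'a \<Rightarrow> real"
  assumes "\<And>x y. x \<in> M \<Longrightarrow> y \<in> M \<Longrightarrow> \<bar>f x - f y\<bar> \<le> c * d x y"
  shows "f \<in> borel_measurable (metric_borel M d)"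
proof (rule borel_measurable_metric_borelI)
  fix x e :: _ assume x: "x \<in> M" "(0::real) < e"
  \<comment> \<open>\<open>c\<close> may be zero or negative; \<open>c'\<close> is a positive upper
    bound that can be divided by.\<close>
  define c' where "c' = \<bar>c\<bar> + 1"
  have c': "c' > 0" by (simp add: c'_def)
  have "\<bar>f x - f y\<bar> < e" if y: "y \<in> M" "d x y < e / c'" for y
  proof -
    have "\<bar>f x - f y\<bar> \<le> c * d x y" using assms x y by blast
    also have "\<dots> \<le> c' * d x y" by (intro mult_right_mono) (auto simp: c'_def)
    also have "\<dots> < e" using y c' by (simp add: field_simps)
    finally show ?thesis .
  qed
  then show "\<exists>\<delta>>0. \<forall>y\<in>M. d x y < \<delta> \<longrightarrow> \<bar>f x - f y\<bar> < e"
    using c' x by (intro exI[of _ "e / c'"]) auto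
qed

section \<open>Test functions of norm at most 1 and their integrals\<close>

lemma bl_norm_leI:
  fixes f :: "'a \<Rightarrow> real"
  assumes "\<And>x. x \<in> M \<Longrightarrow> \<bar>f x\<bar> \<le> a"
    and "\<And>x y. x \<in> M \<Longrightarrow> y \<in> M \<Longrightarrow> \<bar>f x - f y\<bar> \<le> b * d x y"
  shows "bl_norm M d f \<le> ennreal a + ennreal b"
  unfolding bl_norm_def
  by (intro add_mono SUP_least)
     (use assms in \<open>auto intro!: ennreal_leI simp: divide_le_eq dest: mdist_pos_less\<close>)

lemma bl_norm_leD:
  fixes f :: "'a \<Rightarrow> real"
  assumes "bl_norm M d f \<le> 1"
  shows "x \<in> M \<Longrightarrow> \<bar>f x\<bar> \<le> 1" "x \<in> M \<Longrightarrow> y \<in> M \<Longrightarrow> \<bar>f x - f y\<bar> \<le> d x y"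
proof -
  assume x: "x \<in> M"
  have "ennreal \<bar>f x\<bar> \<le> (SUP x\<in>M. ennreal \<bar>f x\<bar>)"
    using x by (rule SUP_upper)
  also have "\<dots> \<le> bl_norm M d f"
    by (simp add: bl_norm_def)
  finally have "ennreal \<bar>f x\<bar> \<le> 1" using assms by (rule order_trans)
  then show "\<bar>f x\<bar> \<le> 1" by simp
next
  assume x: "x \<in> M" "y \<in> M"
  show "\<bar>f x - f y\<bar> \<le> d x y"
  proof (cases "x = y")
    case False
    have "ennreal (\<bar>f x - f y\<bar> / d x y)
        \<le> (SUP (x, y)\<in>{(x, y). x \<in> M \<and> y \<in> M \<and> x \<noteq> y}. ennreal (\<bar>f x - f y\<bar> / d x y))"
      by (rule SUP_upper2[of "(x, y)"]) (use x False in auto)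
    also have "\<dots> \<le> bl_norm M d f"
      by (simp add: bl_norm_def)
    finally have "ennreal (\<bar>f x - f y\<bar> / d x y) \<le> 1" using assms by (rule order_trans)
    then show ?thesis
      using mdist_pos_less[OF False x] by (simp add: divide_le_eq)
  qed (use x in simp)
qed

lemma borel_probsD:
  assumes "P \<in> borel_probs M d"
  shows "prob_space P" "sets P = sets (metric_borel M d)" "space P = M"
  using assms sets_eq_imp_space_eq[of P "metric_borel M d"]
  by (auto simp: borel_probs_def space_metric_borel)

lemma integrable_borel_probs:
  fixes f :: "'a \<Rightarrow> real"
  assumes "P \<in> borel_probs M d" "f \<in> borel_measurable (metric_borel M d)"
    and "\<And>x. x \<in> M \<Longrightarrow> \<bar>f x\<bar> \<le> B"
  shows "integrable P f"
proof -
  interpret prob_space P using borel_probsD assms by blast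
  show ?thesis
    by (rule integrable_const_bound[of _ B])
       (use assms borel_probsD[OF assms(1)] in \<open>auto cong: measurable_cong_sets\<close>)
qed

lemma abs_integral_borel_probs_le:
  fixes f :: "'a \<Rightarrow> real"
  assumes "P \<in> borel_probs M d" "f \<in> borel_measurable (metric_borel M d)"
    and "\<And>x. x \<in> M \<Longrightarrow> \<bar>f x\<bar> \<le> B"
  shows "\<bar>integral\<^sup>L P f\<bar> \<le> B"
proof -
  interpret prob_space P using borel_probsD assms by blast
  have "\<bar>integral\<^sup>L P f\<bar> \<le> integral\<^sup>L P (\<lambda>x. \<bar>f x\<bar>)"
    by (rule integral_abs_bound)
  also have "\<dots> \<le> B"
    by (rule integral_le_const)
       (use assms integrable_borel_probs[OF assms] borel_probsD[OF assms(1)] in auto)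
  finally show ?thesis .
qed

text \<open>A function with \<open>bl_norm\<close> at most 1 is 1-Lipschitz on \<open>M\<close> and
  hence Borel, so measurability and the pointwise bounds are available for free whenever a distance
  is bounded from above.\<close>

lemma bl_distI:
  assumes "0 \<le> c"
    and "\<And>f. f \<in> borel_measurable (metric_borel M d) \<Longrightarrow> (\<And>x. x \<in> M \<Longrightarrow> \<bar>f x\<bar> \<le> 1) \<Longrightarrow>
      (\<And>x y. x \<in> M \<Longrightarrow> y \<in> M \<Longrightarrow> \<bar>f x - f y\<bar> \<le> d x y) \<Longrightarrow>
      bl_norm M d f \<le> 1 \<Longrightarrow> \<bar>integral\<^sup>L \<mu> f - integral\<^sup>L \<nu> f\<bar> \<le> c"
  shows "bl_dist M d \<mu> \<nu> \<le> c"
proof -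
  have "(SUP f\<in>{f. bl_norm M d f \<le> 1}. ennreal \<bar>integral\<^sup>L \<mu> f - integral\<^sup>L \<nu> f\<bar>) \<le> ennreal c"
  proof (intro SUP_least ennreal_leI assms(2))
    fix f assume "f \<in> {f. bl_norm M d f \<le> 1}"
    then show f: "bl_norm M d f \<le> 1" by simp
    show "\<bar>f x\<bar> \<le> 1" if "x \<in> M" for x
      using that by (rule bl_norm_leD(1)[OF f])
    show *: "\<bar>f x - f y\<bar> \<le> d x y" if "x \<in> M" "y \<in> M" for x y
      using that by (rule bl_norm_leD(2)[OF f])
    show "f \<in> borel_measurable (metric_borel M d)"
      by (rule borel_measurable_metric_borel_lipschitz[of _ 1]) (use * in auto)
  qed
  then show ?thesis
    unfolding bl_dist_def using assms(1) by (simp add: enn2real_leI)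
qed

lemma bl_dist_nonneg: "0 \<le> bl_dist M d \<mu> \<nu>"
  by (simp add: bl_dist_def)

lemma bl_dist_commute: "bl_dist M d \<mu> \<nu> = bl_dist M d \<nu> \<mu>"
  by (simp add: bl_dist_def abs_minus_commute)

lemma abs_integral_diff_le_bl_dist_unit:
  fixes f :: "'a \<Rightarrow> real"
  assumes P: "P \<in> borel_probs M d" and Q: "Q \<in> borel_probs M d" and f: "bl_norm M d f \<le> 1"
  shows "\<bar>integral\<^sup>L P f - integral\<^sup>L Q f\<bar> \<le> bl_dist M d P Q"
proof -
  let ?S = "SUP f\<in>{f. bl_norm M d f \<le> 1}. ennreal \<bar>integral\<^sup>L P f - integral\<^sup>L Q f\<bar>"
  \<comment> \<open>Finiteness is essential: \<open>enn2real\<close> maps \<top> to 0 and is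
    monotone only below \<top>.\<close>
  have "?S \<le> ennreal 2"
  proof (intro SUP_least ennreal_leI)
    fix f assume "f \<in> {f. bl_norm M d f \<le> 1}"
    then have f: "bl_norm M d f \<le> 1" by simp
    have "f \<in> borel_measurable (metric_borel M d)"
      by (rule borel_measurable_metric_borel_lipschitz[of _ 1]) (use bl_norm_leD(2)[OF f] in auto)
    then have "\<bar>integral\<^sup>L P f\<bar> \<le> 1" "\<bar>integral\<^sup>L Q f\<bar> \<le> 1"
      using abs_integral_borel_probs_le P Q bl_norm_leD(1)[OF f] by blast+
    then show "\<bar>integral\<^sup>L P f - integral\<^sup>L Q f\<bar> \<le> 2" by linarith
  qed
  then have "?S < \<top>" using le_less_trans by fastforce
  moreover have "ennreal \<bar>integral\<^sup>L P f - integral\<^sup>L Q f\<bar> \<le> ?S"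
    by (rule SUP_upper) (use f in auto)
  ultimately have "enn2real (ennreal \<bar>integral\<^sup>L P f - integral\<^sup>L Q f\<bar>) \<le> enn2real ?S"
    by (intro enn2real_mono)
  then show ?thesis by (simp add: bl_dist_def)
qed

text \<open>Since \<open>a + b\<close> bounds the norm of \<open>f\<close>, division by it gives an
  admissible test function. If \<open>a + b = 0\<close>, then \<open>f\<close> vanishes on
  \<open>M\<close> and both integrals are 0.\<close>

lemma abs_integral_diff_le_bl_dist:
  fixes f :: "'a \<Rightarrow> real"
  assumes P: "P \<in> borel_probs M d" and Q: "Q \<in> borel_probs M d"
    and a: "\<And>x. x \<in> M \<Longrightarrow> \<bar>f x\<bar> \<le> a"
    and b: "\<And>x y. x \<in> M \<Longrightarrow> y \<in> M \<Longrightarrow> \<bar>f x - f y\<bar> \<le> b * d x y"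
    and nn: "0 \<le> b"
  shows "\<bar>integral\<^sup>L P f - integral\<^sup>L Q f\<bar> \<le> (a + b) * bl_dist M d P Q"
proof -
  interpret P: prob_space P using borel_probsD P by blast
  obtain x where "x \<in> M" using P.not_empty borel_probsD[OF P] by auto
  then have a0: "0 \<le> a" using a[of x] by linarith
  show ?thesis
  proof (cases "a + b = 0")
    case True
    then have "f x = 0" if "x \<in> M" for x using a0 nn a[OF that] by linarith
    then have "integral\<^sup>L P f = 0" "integral\<^sup>L Q f = 0"
      using borel_probsD[OF P] borel_probsD[OF Q] by (auto intro!: integral_eq_zero_AE)
    then show ?thesis using True by simp
  next
    case False
    then have c: "a + b > 0" using a0 nn by linarith
    have "bl_norm M d (\<lambda>x. f x / (a + b)) \<le> ennreal (a / (a+b)) + ennreal (b / (a+b))"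
    proof (rule bl_norm_leI)
      fix x y assume "x \<in> M" "y \<in> M"
      then show "\<bar>f x / (a + b) - f y / (a + b)\<bar> \<le> b / (a + b) * d x y"
        using b[of x y] c by (simp add: diff_divide_distrib[symmetric] divide_right_mono)
    qed (use a c in \<open>auto simp: divide_right_mono\<close>)
    also have "\<dots> = 1"
      using a0 nn c by (simp add: ennreal_plus[symmetric] add_divide_distrib[symmetric] del: ennreal_plus)
    finally have "\<bar>integral\<^sup>L P (\<lambda>x. f x / (a + b)) - integral\<^sup>L Q (\<lambda>x. f x / (a + b))\<bar> \<le> bl_dist M d P Q"
      using abs_integral_diff_le_bl_dist_unit[OF P Q] by blast
    then show ?thesis
      using c by (simp add: diff_divide_distrib[symmetric] divide_le_eq mult.commute)
  qed
qed

text \<open>Indicators of open sets are pointwise limits of Lipschitz functions, namely truncated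
  multiples of the distance to the complement. Measures at distance 0 integrate these equally, hence
  agree on the open sets, an intersection-stable generator.\<close>

lemma measure_eq_of_bl_dist_eq_0:
  assumes P: "P \<in> borel_probs M d" and Q: "Q \<in> borel_probs M d" and 0: "bl_dist M d P Q = 0"
  shows "P = Q"
proof -
  interpret P: prob_space P using borel_probsD P by blast
  interpret Q: prob_space Q using borel_probsD Q by blast
  have *: "measure P U = measure Q U" if U: "openin mtopology U" for U
  proof (cases "U = M")
    case True
    then show ?thesis using P.prob_space Q.prob_space borel_probsD(3) P Q by simp
  next
    case False
    \<comment> \<open>The case \<open>U = M\<close> is split off because the infimum defining
      \<open>h\<close> has to range over a nonempty set.\<close>
    define C where "C = M - U"
    have C: "C \<noteq> {}" "C \<subseteq> M" using False openin_subset[OF U] by (auto simp: C_def)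
    define h where "h x = (INF c\<in>C. d x c)" for x
    have bdd: "bdd_below ((\<lambda>c. d x c) ` C)" for x
      by (rule bdd_belowI[of _ 0]) auto
    have h_nn: "0 \<le> h x" for x
      unfolding h_def by (rule cINF_greatest) (use C in auto)
    have h_le: "h x \<le> h y + d x y" if "x \<in> M" "y \<in> M" for x y
    proof -
      have "h x - d x y \<le> h y"
        unfolding h_def[of y]
      proof (rule cINF_greatest)
        fix c assume c: "c \<in> C"
        have "h x \<le> d x c" unfolding h_def by (rule cINF_lower[OF bdd c])
        also have "\<dots> \<le> d x y + d y c" using triangle that c C by blast
        finally show "h x - d x y \<le> d y c" by simp
      qed (use C in simp)
      then show ?thesis by simp
    qed
    have h0: "h x = 0" if "x \<in> C" for x
    proof -
      have "h x \<le> d x x" unfolding h_def by (rule cINF_lower[OF bdd that])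
      then show ?thesis using h_nn[of x] that C by auto
    qed
    have h_pos: "h x > 0" if "x \<in> U" for x
    proof -
      obtain r where r: "r > 0" "mball x r \<subseteq> U"
        using U \<open>x \<in> U\<close> unfolding openin_mtopology by blast
      have "r \<le> h x"
        unfolding h_def
      proof (rule cINF_greatest)
        fix c assume "c \<in> C"
        then show "r \<le> d x c"
          using r C that openin_subset[OF U] by (force simp: C_def not_less[symmetric])
      qed (use C in simp)
      then show ?thesis using r by linarith
    qed
    define f where "f n x = min 1 (real n * h x)" for n :: nat and x
    have f_lip: "\<bar>f n x - f n y\<bar> \<le> real n * d x y" if "x \<in> M" "y \<in> M" for n x y
    proof -
      have "\<bar>h x - h y\<bar> \<le> d x y"
        using h_le[OF that] h_le[OF that(2,1)] commute[of x y] by linarith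
      then have "real n * \<bar>h x - h y\<bar> \<le> real n * d x y" by (simp add: mult_left_mono)
      moreover have "\<bar>real n * h x - real n * h y\<bar> = real n * \<bar>h x - h y\<bar>"
        by (simp add: abs_mult flip: right_diff_distrib)
      ultimately show ?thesis unfolding f_def by linarith
    qed
    have f_bd: "\<bar>f n x\<bar> \<le> 1" for n x
      using h_nn[of x] by (simp add: f_def)
    have f_meas: "f n \<in> borel_measurable (metric_borel M d)" for n
      by (rule borel_measurable_metric_borel_lipschitz) (rule f_lip)
    have f_lim: "(\<lambda>n. f n x) \<longlonglongrightarrow> indicator U x" if "x \<in> M" for x
    proof (cases "x \<in> U")
      case True
      obtain N :: nat where N: "1 / h x \<le> real N" using real_arch_simple by blast
      have "eventually (\<lambda>n. f n x = 1) sequentially"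
        using eventually_ge_at_top[of N]
      proof eventually_elim
        case (elim n)
        then have "1 / h x \<le> real n" using N by linarith
        then show ?case using h_pos[OF True] by (simp add: f_def field_simps)
      qed
      then show ?thesis using True by (simp add: tendsto_eventually)
    next
      case False
      then have "h x = 0" using h0 that by (simp add: C_def)
      then show ?thesis using False by (simp add: f_def)
    qed
    have lim: "(\<lambda>n. integral\<^sup>L R (f n)) \<longlonglongrightarrow> measure R U" if R: "R \<in> borel_probs M d" for R
    proof -
      interpret R: prob_space R using borel_probsD R by blast
      have US: "U \<in> sets R" using borel_probsD[OF R] openin_imp_sets_metric_borel[OF U] by simp
      have "(\<lambda>n. integral\<^sup>L R (f n)) \<longlonglongrightarrow> integral\<^sup>L R (indicator U :: _ \<Rightarrow> real)"
      proof (rule integral_dominated_convergence)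
        show "f n \<in> borel_measurable R" for n
          using f_meas borel_probsD(2)[OF R] by (simp cong: measurable_cong_sets)
        show "AE x in R. (\<lambda>n. f n x) \<longlonglongrightarrow> indicator U x"
          using f_lim borel_probsD(3)[OF R] by (intro AE_I2) auto
      qed (use US f_bd in auto)
      then show ?thesis using US by simp
    qed
    have "integral\<^sup>L P (f n) = integral\<^sup>L Q (f n)" for n
      using abs_integral_diff_le_bl_dist[OF P Q, of "f n" 1 "real n"] f_bd f_lip 0 by simp
    then show ?thesis
      using LIMSEQ_unique[OF lim[OF P]] lim[OF Q] by simp
  qed
  show ?thesis
  proof (rule measure_eqI_generator_eq[where E = "{U. openin mtopology U}" and \<Omega> = M and A = "\<lambda>_. M"])
    show "Int_stable {U. openin mtopology U}" by (auto simp: Int_stable_def)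
    show "{U. openin mtopology U} \<subseteq> Pow M" using openin_subset by fastforce
    show "emeasure P U = emeasure Q U" if "U \<in> {U. openin mtopology U}" for U
      using * that by (simp add: P.emeasure_eq_measure Q.emeasure_eq_measure)
  qed (use borel_probsD[OF P] borel_probsD[OF Q] sets_metric_borel in auto)
qed

text \<open>Lets the facts of this context be reused with \<open>borel_probs M d\<close> as carrier,
  as the distance between laws of laws requires.\<close>

lemma Metric_space_bl_dist: "Metric_space (borel_probs M d) (bl_dist M d)"
proof
  fix P Q R assume P: "P \<in> borel_probs M d" and Q: "Q \<in> borel_probs M d" 
  show "bl_dist M d P Q = 0 \<longleftrightarrow> P = Q"
  proof
    assume "P = Q"
    have "bl_dist M d P P \<le> 0" by (rule bl_distI) auto
    with \<open>P = Q\<close> show "bl_dist M d P Q = 0" using bl_dist_nonneg[of P Q] by simp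
  qed (rule measure_eq_of_bl_dist_eq_0[OF P Q])
  assume R: "R \<in> borel_probs M d"
  show "bl_dist M d P R \<le> bl_dist M d P Q + bl_dist M d Q R"
  proof (rule bl_distI)
    fix f assume f: "bl_norm M d f \<le> 1"
    show "\<bar>integral\<^sup>L P f - integral\<^sup>L R f\<bar> \<le> bl_dist M d P Q + bl_dist M d Q R"
      using abs_integral_diff_le_bl_dist_unit[OF P Q f] abs_integral_diff_le_bl_dist_unit[OF Q R f]
      by linarith
  qed (simp add: bl_dist_nonneg)
qed (rule bl_dist_nonneg bl_dist_commute)+

end

section \<open>Uniform concentration of empirical measures\<close>

context Metric_space
begin

text \<open>A 1-Lipschitz test function is within \<open>\<eta>\<close> of a step function on cells
  contained in balls of radius \<open>\<eta>\<close>. Replacing it under both measures costs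
  \<open>2 * \<eta>\<close>, and the integrals of the step function differ by at most the sum
  because its values are bounded by 1. The cells are chosen before the measures, which is the source
  of uniformity in the sampled measure.\<close>

lemma finite_partition_bl_dist:
  assumes tb: "mtotally_bounded M" and \<eta>: "0 < \<eta>"
  shows "\<exists>(N :: nat) A. (\<forall>j. A j \<in> sets (metric_borel M d)) \<and>
    (\<forall>P\<in>borel_probs M d. \<forall>Q\<in>borel_probs M d.
      bl_dist M d P Q \<le> 2 * \<eta> + (\<Sum>j<N. \<bar>measure P (A j) - measure Q (A j)\<bar>))"
proof -
  obtain K where K: "finite K" "K \<subseteq> M" "M \<subseteq> (\<Union>x\<in>K. mball x \<eta>)"
    using tb \<eta> unfolding mtotally_bounded_def by (elim allE[of _ \<eta>]) auto
  obtain a :: "nat \<Rightarrow> 'a" and N where a: "K = a ` {..<N}"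
    using finite_imp_nat_seg_image_inj_on[OF K(1)] unfolding lessThan_def by blast
  \<comment> \<open>Removing the earlier balls makes the cover disjoint; some cells may be
    empty.\<close>
  define A where "A j = mball (a j) \<eta> - (\<Union>i<j. mball (a i) \<eta>)" for j
  have A_sets: "A j \<in> sets (metric_borel M d)" for j
    unfolding A_def by (intro sets.Diff sets.finite_UN mball_in_sets_metric_borel) auto
  have A_disj: "i = j" if "x \<in> A i" "x \<in> A j" for i j x
    using that unfolding A_def by (cases i j rule: linorder_cases) auto
  have A_cover: "\<exists>j<N. x \<in> A j" if "x \<in> M" for x
  proof -
    define j where "j = (LEAST j. x \<in> mball (a j) \<eta>)"
    obtain j' where j': "j' < N" "x \<in> mball (a j') \<eta>"
      using subsetD[OF K(3) \<open>x \<in> M\<close>] unfolding a by auto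
    have 1: "x \<in> mball (a j) \<eta>" unfolding j_def by (rule LeastI[of "\<lambda>j. x \<in> mball (a j) \<eta>", OF j'(2)])
    have 2: "j \<le> j'" unfolding j_def by (rule Least_le[of "\<lambda>j. x \<in> mball (a j) \<eta>", OF j'(2)])
    have "x \<notin> mball (a i) \<eta>" if "i < j" for i
      using not_less_Least[of i "\<lambda>j. x \<in> mball (a j) \<eta>"] that unfolding j_def by blast
    then show ?thesis using 1 2 j' by (intro exI[of _ j]) (auto simp: A_def)
  qed
  show ?thesis
  proof (rule exI[of _ N], rule exI[of _ A], intro conjI allI ballI)
    fix P Q assume P: "P \<in> borel_probs M d" and Q: "Q \<in> borel_probs M d"
    show "bl_dist M d P Q \<le> 2 * \<eta> + (\<Sum>j<N. \<bar>measure P (A j) - measure Q (A j)\<bar>)"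
    proof (rule bl_distI)
      fix f :: "'a \<Rightarrow> real"
      assume f: "f \<in> borel_measurable (metric_borel M d)" "\<And>x. x \<in> M \<Longrightarrow> \<bar>f x\<bar> \<le> 1"
        "\<And>x y. x \<in> M \<Longrightarrow> y \<in> M \<Longrightarrow> \<bar>f x - f y\<bar> \<le> d x y"
      define g where "g x = (\<Sum>j<N. f (a j) * indicator (A j) x)" for x
      have g_eq: "g x = f (a j)" if "j < N" "x \<in> A j" for x j
      proof -
        have "g x = (\<Sum>i<N. if i = j then f (a j) else 0)"
          unfolding g_def using A_disj that(2) by (intro sum.cong) (auto simp: indicator_def)
        also have "\<dots> = f (a j)" using that by simp
        finally show ?thesis .
      qed
      have fg: "\<bar>f x - g x\<bar> \<le> \<eta>" if "x \<in> M" for x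
      proof -
        obtain j where j: "j < N" "x \<in> A j" using A_cover \<open>x \<in> M\<close> by blast
        then have "x \<in> mball (a j) \<eta>" by (simp add: A_def)
        then have "a j \<in> M" "d (a j) x < \<eta>" by auto
        then show ?thesis
          using f(3)[of x "a j"] g_eq[OF j] \<open>x \<in> M\<close> commute[of x "a j"] by auto
      qed
      have g_meas: "g \<in> borel_measurable (metric_borel M d)"
        unfolding g_def using A_sets by measurable
      have int: "\<bar>integral\<^sup>L R f - integral\<^sup>L R g\<bar> \<le> \<eta>"
        "integral\<^sup>L R g = (\<Sum>j<N. f (a j) * measure R (A j))" if R: "R \<in> borel_probs M d" for R
      proof -
        interpret R: prob_space R using borel_probsD R by blast
        have AR: "A j \<in> sets R" for j using A_sets borel_probsD(2)[OF R] by simp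
        have "\<bar>g x\<bar> \<le> 1 + \<eta>" if "x \<in> M" for x using fg[OF that] f(2)[OF that] by linarith
        then have gi: "integrable R g" using integrable_borel_probs[OF R g_meas] by blast
        have fi: "integrable R f" using integrable_borel_probs[OF R f(1)] f(2) by blast
        have "\<bar>integral\<^sup>L R (\<lambda>x. f x - g x)\<bar> \<le> \<eta>"
          using abs_integral_borel_probs_le[OF R] f(1) g_meas fg by auto
        then show "\<bar>integral\<^sup>L R f - integral\<^sup>L R g\<bar> \<le> \<eta>"
          using fi gi by simp
        show "integral\<^sup>L R g = (\<Sum>j<N. f (a j) * measure R (A j))"
          unfolding g_def using AR
          by (subst Bochner_Integration.integral_sum) (auto simp: R.emeasure_eq_measure)
      qed
      have "\<bar>integral\<^sup>L P g - integral\<^sup>L Q g\<bar> = \<bar>\<Sum>j<N. f (a j) * (measure P (A j) - measure Q (A j))\<bar>"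
        using int(2)[OF P] int(2)[OF Q] by (simp add: sum_subtractf right_diff_distrib)
      also have "\<dots> \<le> (\<Sum>j<N. \<bar>f (a j)\<bar> * \<bar>measure P (A j) - measure Q (A j)\<bar>)"
        using sum_abs[of "\<lambda>j. f (a j) * (measure P (A j) - measure Q (A j))" "{..<N}"]
        by (simp add: abs_mult)
      also have "\<dots> \<le> (\<Sum>j<N. \<bar>measure P (A j) - measure Q (A j)\<bar>)"
      proof (rule sum_mono)
        fix j assume "j \<in> {..<N}"
        then have "\<bar>f (a j)\<bar> \<le> 1" using f(2) K(2) a by blast
        from mult_right_mono[OF this] show "\<bar>f (a j)\<bar> * \<bar>measure P (A j) - measure Q (A j)\<bar>
          \<le> \<bar>measure P (A j) - measure Q (A j)\<bar>" by fastforce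
      qed
      finally show "\<bar>integral\<^sup>L P f - integral\<^sup>L Q f\<bar>
          \<le> 2 * \<eta> + (\<Sum>j<N. \<bar>measure P (A j) - measure Q (A j)\<bar>)"
        using int(1)[OF P] int(1)[OF Q] by linarith
    qed (use \<eta> in \<open>auto intro: sum_nonneg\<close>)
  qed (rule A_sets)
qed

end

section \<open>Mean deviation of empirical probabilities\<close>

lemma measure_emp_measure:
  assumes "A \<in> sets (metric_borel Z dZ)" "0 < n"
  shows "measure (emp_measure Z dZ n z) A = (\<Sum>i<n. indicator A (z i)) / real n"
proof -
  have "(\<Sum>i<n. indicator A (z i) :: ennreal) = ennreal (\<Sum>i<n. indicator A (z i))"
    by (subst sum_ennreal[symmetric]) (auto simp: ennreal_indicator)
  then have "emeasure (emp_measure Z dZ n z) A = ennreal ((\<Sum>i<n. indicator A (z i)) / real n)"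
    using assms by (simp add: emeasure_emp_measure ennreal_of_nat_eq_real_of_nat divide_ennreal sum_nonneg)
  then show ?thesis
    by (simp add: measure_def sum_nonneg)
qed

text \<open>Independence and centring remove the off-diagonal terms of the expanded square; each of
  the \<open>n\<close> diagonal terms is at most 1.\<close>

lemma (in prob_space) integral_PiM_sum_power2_le:
  fixes f :: "'a \<Rightarrow> real" and n :: nat
  assumes f [measurable]: "f \<in> borel_measurable M" and bd: "\<And>x. x \<in> space M \<Longrightarrow> \<bar>f x\<bar> \<le> 1"
    and cent: "integral\<^sup>L M f = 0"
  shows "integrable (Pi\<^sub>M {..<n} (\<lambda>_. M)) (\<lambda>z. (\<Sum>i<n. f (z i))\<^sup>2)"
    "(\<integral>z. (\<Sum>i<n. f (z i))\<^sup>2 \<partial>Pi\<^sub>M {..<n} (\<lambda>_. M)) \<le> real n"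
proof -
  interpret Pn: prob_space "Pi\<^sub>M {..<n} (\<lambda>_. M)" by (rule prob_space_PiM) (rule prob_space_axioms)
  interpret PP: product_prob_space "\<lambda>_::nat. M" ..
  have fint: "integrable M f"
    by (rule integrable_const_bound[of _ 1]) (use bd in auto)
  have bd2: "\<bar>f x * f y\<bar> \<le> 1" if "x \<in> space M" "y \<in> space M" for x y
    using mult_mono[OF bd[OF that(1)] bd[OF that(2)]] by (simp add: abs_mult)
  have fint2: "integrable M (\<lambda>x. f x * f x)"
    by (rule integrable_const_bound[of _ 1]) (auto simp only: real_norm_def intro!: AE_I2 bd2, measurable)
  \<comment> \<open>Writes \<open>f (z i) * f (z j)\<close> as a product over all coordinates
    \<open>l\<close>, the shape to which the product integral formula applies. For
    \<open>i = j\<close> the factor at \<open>l = i\<close> is the square of \<open>f\<close>, so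
    both cases are covered at once.\<close>
  define g where "g i j l x = (if l = i then f x else 1) * (if l = j then f x else 1)" for i j l :: nat and x
  have gint: "integrable M (g i j l)" for i j l
    unfolding g_def using fint fint2 by (cases "l = i"; cases "l = j") simp_all
  have g_prod: "(\<Prod>l<n. g i j l (z l)) = f (z i) * f (z j)" if "i < n" "j < n" for i j z
    unfolding g_def prod.distrib using that by (simp add: prod.delta)
  have int: "integrable (Pi\<^sub>M {..<n} (\<lambda>_. M)) (\<lambda>z. f (z i) * f (z j))" if "i < n" "j < n" for i j
    using PP.product_integrable_prod[of "{..<n}" "g i j"] gint g_prod[OF that] by simp
  have val: "(\<integral>z. f (z i) * f (z j) \<partial>Pi\<^sub>M {..<n} (\<lambda>_. M)) \<le> (if i = j then 1 else 0)"
    if "i < n" "j < n" for i j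
  proof -
    have *: "(\<integral>z. f (z i) * f (z j) \<partial>Pi\<^sub>M {..<n} (\<lambda>_. M)) = (\<Prod>l<n. integral\<^sup>L M (g i j l))"
      using PP.product_integral_prod[of "{..<n}" "g i j"] gint g_prod[OF that] by simp
    show ?thesis
    proof (cases "i = j")
      case False
      then have "g i j i = f" by (intro ext) (simp add: g_def)
      then have "integral\<^sup>L M (g i j i) = 0" using cent by simp
      then have "(\<Prod>l<n. integral\<^sup>L M (g i j l)) = 0" using that by (auto intro!: prod_zero)
      from trans[OF * this] show ?thesis by simp
    next
      case True
      have "\<bar>f (z i) * f (z j)\<bar> \<le> 1" if "z \<in> space (Pi\<^sub>M {..<n} (\<lambda>_. M))" for z
        using that \<open>i < n\<close> \<open>j < n\<close> by (intro bd2) (auto simp: space_PiM PiE_iff)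
      then have "(\<integral>z. f (z i) * f (z j) \<partial>Pi\<^sub>M {..<n} (\<lambda>_. M)) \<le> 1"
        using int[OF that] by (intro Pn.integral_le_const AE_I2) (auto simp: abs_le_iff)
      then show ?thesis using True by simp
    qed
  qed
  have eq: "(\<Sum>i<n. f (z i))\<^sup>2 = (\<Sum>i<n. \<Sum>j<n. f (z i) * f (z j))" for z
    by (simp add: power2_eq_square sum_product)
  show "integrable (Pi\<^sub>M {..<n} (\<lambda>_. M)) (\<lambda>z. (\<Sum>i<n. f (z i))\<^sup>2)"
    unfolding eq by (intro Bochner_Integration.integrable_sum int) auto
  have "(\<integral>z. (\<Sum>i<n. f (z i))\<^sup>2 \<partial>Pi\<^sub>M {..<n} (\<lambda>_. M))
      = (\<Sum>i<n. \<integral>z. (\<Sum>j<n. f (z i) * f (z j)) \<partial>Pi\<^sub>M {..<n} (\<lambda>_. M))"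
    unfolding eq
    by (intro Bochner_Integration.integral_sum Bochner_Integration.integrable_sum int) auto
  also have "\<dots> = (\<Sum>i<n. \<Sum>j<n. \<integral>z. f (z i) * f (z j) \<partial>Pi\<^sub>M {..<n} (\<lambda>_. M))"
    by (intro sum.cong refl Bochner_Integration.integral_sum int) auto
  also have "\<dots> \<le> (\<Sum>i<n. \<Sum>j<n. if i = j then 1 else 0)"
    by (intro sum_mono) (use val in auto)
  also have "\<dots> = real n" by simp
  finally show "(\<integral>z. (\<Sum>i<n. f (z i))\<^sup>2 \<partial>Pi\<^sub>M {..<n} (\<lambda>_. M)) \<le> real n" .
qed

context Metric_space
begin

text \<open>The deviation is the modulus of a centred sum of \<open>n\<close> independent terms
  bounded by 1, divided by \<open>n\<close>; the second moment controls it with constants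
  independent of \<open>Q\<close> and \<open>A\<close>.\<close>

lemma integral_abs_measure_emp_measure_diff_le:
  assumes Q: "Q \<in> borel_probs M d" and A: "A \<in> sets (metric_borel M d)" and n: "0 < n"
  shows "integrable (Pi\<^sub>M {..<n} (\<lambda>_. Q)) (\<lambda>z. \<bar>measure (emp_measure M d n z) A - measure Q A\<bar>)"
    "(\<integral>z. \<bar>measure (emp_measure M d n z) A - measure Q A\<bar> \<partial>Pi\<^sub>M {..<n} (\<lambda>_. Q)) \<le> 1 / sqrt (real n)"
proof -
  interpret Q: prob_space Q using borel_probsD Q by blast
  interpret Pn: prob_space "Pi\<^sub>M {..<n} (\<lambda>_. Q)" by (rule prob_space_PiM) (rule Q.prob_space_axioms)
  have AQ [measurable]: "A \<in> sets Q" using A borel_probsD(2)[OF Q] by simp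
  define f where "f x = indicator A x - measure Q A" for x
  have f [measurable]: "f \<in> borel_measurable Q" unfolding f_def by measurable
  have f_bd: "\<bar>f x\<bar> \<le> 1" for x
    using Q.prob_le_1[of A] measure_nonneg[of Q A] by (auto simp: f_def indicator_def)
  have f_0: "integral\<^sup>L Q f = 0"
    unfolding f_def by (subst Bochner_Integration.integral_diff)
       (auto simp: Q.prob_space intro!: integrable_real_indicator Q.emeasure_finite[THEN top.not_eq_extremum[THEN iffD1]])
  have eq: "measure (emp_measure M d n z) A - measure Q A = (\<Sum>i<n. f (z i)) / real n" for z
    using n by (simp add: measure_emp_measure[OF A n] f_def sum_subtractf field_simps)
  note sq = Q.integral_PiM_sum_power2_le[OF f f_bd f_0, of n]
  \<comment> \<open>Expanding \<open>(\<bar>s\<bar> / sqrt n - 1)\<^sup>2 \<ge> 0\<close> bounds the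
    first moment by the second in place of Cauchy-Schwarz for integrals. If the second moment of
    \<open>s\<close> is \<open>n\<close>, the right side has expectation exactly
    \<open>1 / sqrt n\<close>.\<close>
  have bound: "\<bar>s / real n\<bar> \<le> (s\<^sup>2 / real n + 1) / (2 * sqrt (real n))" for s
  proof -
    define r where "r = sqrt (real n)"
    have r: "r > 0" "real n = r\<^sup>2" using n by (auto simp: r_def)
    have "0 \<le> (\<bar>s\<bar> / r - 1)\<^sup>2" by simp
    then have "2 * \<bar>s\<bar> / r \<le> s\<^sup>2 / r\<^sup>2 + 1"
      by (simp add: power2_diff power_divide)
    then have "2 * \<bar>s\<bar> / r / (2 * r) \<le> (s\<^sup>2 / r\<^sup>2 + 1) / (2 * r)"
      using r by (intro divide_right_mono) auto
    then show ?thesis using r by (simp add: power2_eq_square r_def[symmetric])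
  qed
  have meas [measurable]: "(\<lambda>z. \<Sum>i<n. f (z i)) \<in> borel_measurable (Pi\<^sub>M {..<n} (\<lambda>_. Q))"
    by measurable
  have int: "integrable (Pi\<^sub>M {..<n} (\<lambda>_. Q)) (\<lambda>z. ((\<Sum>i<n. f (z i))\<^sup>2 / real n + 1) / (2 * sqrt (real n)))"
    using sq(1) by auto
  show I: "integrable (Pi\<^sub>M {..<n} (\<lambda>_. Q)) (\<lambda>z. \<bar>measure (emp_measure M d n z) A - measure Q A\<bar>)"
    unfolding eq
    by (rule Bochner_Integration.integrable_bound[OF int])
       (use bound in \<open>auto intro!: AE_I2 order_trans[OF _ abs_ge_self]\<close>)
  have "(\<integral>z. \<bar>measure (emp_measure M d n z) A - measure Q A\<bar> \<partial>Pi\<^sub>M {..<n} (\<lambda>_. Q))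
     \<le> (\<integral>z. ((\<Sum>i<n. f (z i))\<^sup>2 / real n + 1) / (2 * sqrt (real n)) \<partial>Pi\<^sub>M {..<n} (\<lambda>_. Q))"
    by (rule integral_mono[OF I int]) (use bound eq in simp)
  also have "\<dots> = ((\<integral>z. (\<Sum>i<n. f (z i))\<^sup>2 \<partial>Pi\<^sub>M {..<n} (\<lambda>_. Q)) / real n + 1) / (2 * sqrt (real n))"
    using sq(1) by (simp add: Pn.prob_space)
  also have "\<dots> \<le> (1 + 1) / (2 * sqrt (real n))"
    using sq(2) n by (intro divide_right_mono add_right_mono) (auto simp: divide_le_eq)
  finally show "(\<integral>z. \<bar>measure (emp_measure M d n z) A - measure Q A\<bar> \<partial>Pi\<^sub>M {..<n} (\<lambda>_. Q)) \<le> 1 / sqrt (real n)"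
    by simp
qed

end

section \<open>Bootstrapping statistics that are uniformly continuous\<close>

text \<open>Seeing the empirical measure as the law of \<open>z\<close> at a uniformly random index
  turns integrals into averages and, later, resampling into drawing indices.\<close>

lemma emp_measure_eq_distr:
  assumes n: "0 < n" and z: "\<And>i. i < n \<Longrightarrow> z i \<in> Z"
  shows "emp_measure Z dZ n z = distr (uniform_count_measure {..<n}) (metric_borel Z dZ) z"
proof (rule measure_eqI)
  fix A assume "A \<in> sets (emp_measure Z dZ n z)"
  then have A: "A \<in> sets (metric_borel Z dZ)" by (simp add: sets_emp_measure)
  have [measurable]: "z \<in> uniform_count_measure {..<n} \<rightarrow>\<^sub>M metric_borel Z dZ"
    using z by (auto simp: measurable_def space_metric_borel space_uniform_count_measure
        sets_uniform_count_measure)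
  have "(\<Sum>i<n. indicator A (z i) :: ennreal) = of_nat (card ({..<n} \<inter> {i. z i \<in> A}))"
    using sum_of_bool_eq[of "{..<n}" "\<lambda>i. z i \<in> A"] by (simp add: indicator_def)
  also have "{..<n} \<inter> {i. z i \<in> A} = z -` A \<inter> {..<n}"
    by auto
  finally show "emeasure (emp_measure Z dZ n z) A
      = emeasure (distr (uniform_count_measure {..<n}) (metric_borel Z dZ) z) A"
    using A n by (simp add: emeasure_emp_measure emeasure_distr emeasure_uniform_count_measure
        space_uniform_count_measure ennreal_of_nat_eq_real_of_nat divide_ennreal)
qed (simp add: sets_emp_measure)

lemma integral_emp_measure:
  fixes f :: "'z \<Rightarrow> real"
  assumes "0 < n" "\<And>i. i < n \<Longrightarrow> z i \<in> Z" "f \<in> borel_measurable (metric_borel Z dZ)"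
  shows "integral\<^sup>L (emp_measure Z dZ n z) f = (\<Sum>i<n. f (z i)) / real n"
proof -
  have "z \<in> uniform_count_measure {..<n} \<rightarrow>\<^sub>M metric_borel Z dZ"
    using assms by (auto simp: measurable_def space_metric_borel space_uniform_count_measure
        sets_uniform_count_measure)
  then show ?thesis
    using assms by (simp add: emp_measure_eq_distr integral_distr integral_uniform_count_measure)
qed

text \<open>Continuity in the sample points for one fixed \<open>n\<close>, so
  \<open>\<delta>\<close> may depend on \<open>n\<close>. It serves to make the sampling laws
  measurable images and contributes nothing to the rates.\<close>

definition sample_unif_cont ::
  "'z set \<Rightarrow> ('z \<Rightarrow> 'z \<Rightarrow> real) \<Rightarrow> ('w \<Rightarrow> 'w \<Rightarrow> real) \<Rightarrow> nat \<Rightarrow> ('z measure \<Rightarrow> 'w) \<Rightarrow> bool" where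
  "sample_unif_cont Z dZ dW n F \<longleftrightarrow> (\<forall>e>0. \<exists>\<delta>>0. \<forall>z z'.
     (\<forall>i<n. z i \<in> Z \<and> z' i \<in> Z \<and> dZ (z i) (z' i) < \<delta>) \<longrightarrow>
     dW (F (emp_measure Z dZ n z)) (F (emp_measure Z dZ n z')) < e)"

text \<open>Comparing \<open>G n\<close> at \<open>P\<close> with \<open>G0\<close> at a different,
  nearby \<open>Q\<close> combines uniform convergence of \<open>G n\<close> to \<open>G0\<close>
  with uniform continuity of \<open>G0\<close>. The thresholds do not depend on the measures, and
  the statistic may vary with \<open>n\<close>, so a sampling law can take the place of
  \<open>G n\<close>.\<close>

definition asymp_equicont ::
  "'z set \<Rightarrow> ('z \<Rightarrow> 'z \<Rightarrow> real) \<Rightarrow> ('w \<Rightarrow> 'w \<Rightarrow> real) \<Rightarrow> (nat \<Rightarrow> 'z measure \<Rightarrow> 'w) \<Rightarrow>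
   ('z measure \<Rightarrow> 'w) \<Rightarrow> bool" where
  "asymp_equicont Z dZ dW G G0 \<longleftrightarrow> (\<forall>e>0. \<exists>\<delta>>0. \<exists>n0\<ge>1. \<forall>n\<ge>n0.
     \<forall>P\<in>borel_probs Z dZ. \<forall>Q\<in>borel_probs Z dZ. bl_dist Z dZ P Q < \<delta> \<longrightarrow> dW (G n P) (G0 Q) < e)"

context Metric_space
begin

text \<open>Pairs the atoms index by index: a 1-Lipschitz function changes by at most
  \<open>\<delta>\<close> at each of them, hence also on average.\<close>

lemma bl_dist_emp_measure_le:
  assumes n: "0 < n" and z: "\<And>i. i < n \<Longrightarrow> z i \<in> M \<and> z' i \<in> M \<and> d (z i) (z' i) \<le> \<delta>"
  shows "bl_dist M d (emp_measure M d n z) (emp_measure M d n z') \<le> \<delta>"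
proof (rule bl_distI)
  show "0 \<le> \<delta>" using z[of 0] n nonneg order_trans by blast
  fix f :: "'a \<Rightarrow> real"
  assume f: "f \<in> borel_measurable (metric_borel M d)"
    "\<And>x y. x \<in> M \<Longrightarrow> y \<in> M \<Longrightarrow> \<bar>f x - f y\<bar> \<le> d x y"
  have "\<bar>(\<Sum>i<n. f (z i)) - (\<Sum>i<n. f (z' i))\<bar> \<le> (\<Sum>i<n. \<bar>f (z i) - f (z' i)\<bar>)"
    by (simp add: sum_subtractf[symmetric])
  also have "\<dots> \<le> (\<Sum>i<n. \<delta>)"
    by (rule sum_mono) (use f(2) z order_trans in blast)
  finally show "\<bar>integral\<^sup>L (emp_measure M d n z) f - integral\<^sup>L (emp_measure M d n z') f\<bar> \<le> \<delta>"
    using n z f(1) by (simp add: integral_emp_measure diff_divide_distrib[symmetric] divide_le_eq mult.commute)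
qed

text \<open>Each point of \<open>V\<close> lies in a box of small balls inside \<open>V\<close>.
  Centres from finite nets and radii \<open>1 / (m + 1)\<close> suffice, so \<open>V\<close> is a
  countable union of boxes. This reconciles the product sigma algebra with openness in the maximum
  distance on tuples.\<close>

lemma sets_PiM_metric_borel_openI:
  assumes tb: "mtotally_bounded M" and V: "V \<subseteq> (\<Pi>\<^sub>E i\<in>{..<n::nat}. M)"
    and op: "\<And>z. z \<in> V \<Longrightarrow>
      \<exists>\<delta>>0. \<forall>z'\<in>(\<Pi>\<^sub>E i\<in>{..<n}. M). (\<forall>i<n. d (z i) (z' i) < \<delta>) \<longrightarrow> z' \<in> V"
  shows "V \<in> sets (Pi\<^sub>M {..<n} (\<lambda>_. metric_borel M d))"
proof -
  have "\<forall>m::nat. \<exists>K. finite K \<and> K \<subseteq> M \<and> M \<subseteq> (\<Union>x\<in>K. mball x (1 / (real m + 1)))"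
    using tb unfolding mtotally_bounded_def by simp
  then obtain K where K: "\<And>m::nat. finite (K m)" "\<And>m. K m \<subseteq> M"
    "\<And>m. M \<subseteq> (\<Union>x\<in>K m. mball x (1 / (real m + 1)))"
    by metis
  define B where "B m a = (\<Pi>\<^sub>E i\<in>{..<n}. mball (a i) (1 / (real m + 1)))" for m :: nat and a :: "nat \<Rightarrow> 'a"
  define I where "I m = {a \<in> (\<Pi>\<^sub>E i\<in>{..<n}. K m). B m a \<subseteq> V}" for m
  have fin: "finite (I m)" for m
    unfolding I_def using K(1) by (intro finite_subset[OF _ finite_PiE[of "{..<n}" "\<lambda>_. K m"]]) auto
  have "V \<subseteq> (\<Union>m. \<Union>a\<in>I m. B m a)"
  proof
    fix z assume z: "z \<in> V"
    obtain \<delta> where \<delta>: "\<delta> > 0"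
      "\<And>z'. z' \<in> (\<Pi>\<^sub>E i\<in>{..<n}. M) \<Longrightarrow> (\<forall>i<n. d (z i) (z' i) < \<delta>) \<Longrightarrow> z' \<in> V"
      using op[OF z] by auto
    obtain m :: nat where m: "2 / \<delta> < real m" using reals_Archimedean2 by blast
    then have m2: "2 / (real m + 1) < \<delta>" using \<delta>(1) by (simp add: field_simps)
    \<comment> \<open>Two points of one ball of radius \<open>1 / (m + 1)\<close> are less than
      \<open>2 / (m + 1) < \<delta>\<close> apart, so every box of level \<open>m\<close> that
      contains \<open>z\<close> stays in \<open>V\<close>.\<close>
    have zM: "z i \<in> M" if "i < n" for i using z V that by auto
    have "\<exists>a\<in>K m. z i \<in> mball a (1 / (real m + 1))" if "i < n" for i
      using subsetD[OF K(3) zM[OF that]] by auto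
    then obtain a where a: "\<And>i. i < n \<Longrightarrow> a i \<in> K m \<and> z i \<in> mball (a i) (1 / (real m + 1))"
      by metis
    define a' where "a' = restrict a {..<n}"
    have zB: "z \<in> B m a'"
      using z V a by (auto simp: B_def a'_def PiE_iff)
    have "B m a' \<subseteq> V"
    proof
      fix z' assume z': "z' \<in> B m a'"
      show "z' \<in> V"
      proof (rule \<delta>(2))
        show "z' \<in> (\<Pi>\<^sub>E i\<in>{..<n}. M)" using z' by (auto simp: B_def PiE_iff)
        show "\<forall>i<n. d (z i) (z' i) < \<delta>"
        proof (intro allI impI)
          fix i assume i: "i < n"
          have "z' i \<in> mball (a i) (1 / (real m + 1))" "z i \<in> mball (a i) (1 / (real m + 1))"
            using z' a i by (auto simp: B_def a'_def PiE_iff)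
          then have "d (z i) (z' i) < 2 / (real m + 1)"
            using triangle''[of "z i" "a i" "z' i"] by auto
          then show "d (z i) (z' i) < \<delta>" using m2 by linarith
        qed
      qed
    qed
    then have "a' \<in> I m" using a by (auto simp: I_def a'_def)
    then show "z \<in> (\<Union>m. \<Union>a\<in>I m. B m a)" using zB by blast
  qed
  then have "V = (\<Union>m. \<Union>a\<in>I m. B m a)" by (auto simp: I_def)
  also have "\<dots> \<in> sets (Pi\<^sub>M {..<n} (\<lambda>_. metric_borel M d))"
    unfolding B_def
    by (intro sets.countable_UN'' sets.finite_UN fin sets_PiM_I_finite mball_in_sets_metric_borel) auto
  finally show ?thesis .
qed

end

lemma measurable_PiM_sets_cong:
  assumes "sets P = sets N" "f \<in> Pi\<^sub>M I (\<lambda>_. N) \<rightarrow>\<^sub>M K"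
  shows "f \<in> Pi\<^sub>M I (\<lambda>_. P) \<rightarrow>\<^sub>M K"
proof -
  have "sets (Pi\<^sub>M I (\<lambda>_. P)) = sets (Pi\<^sub>M I (\<lambda>_. N))" by (rule sets_PiM_cong) (use assms in auto)
  then show ?thesis using assms(2) measurable_cong_sets by blast
qed

text \<open>\<open>W\<close> is instantiated both by the target of the statistic and by the space of
  laws on it, so that one set of lemmas serves both levels of the bootstrap.\<close>

locale two_metrics = Z: Metric_space Z dZ + W: Metric_space W dW
  for Z :: "'z set" and dZ and W :: "'w set" and dW +
  assumes Z_tb: "Z.mtotally_bounded Z"
begin

text \<open>Uniform continuity in the sample makes preimages of open sets open among tuples, hence
  measurable in the product. This is what makes \<open>stat_law\<close> a genuine image
  measure.\<close>

lemma measurable_sample: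
  assumes n: "0 < n" and F: "\<And>P. P \<in> borel_probs Z dZ \<Longrightarrow> F P \<in> W"
    and uc: "sample_unif_cont Z dZ dW n F"
  shows "(\<lambda>z. F (emp_measure Z dZ n z)) \<in> Pi\<^sub>M {..<n} (\<lambda>_. metric_borel Z dZ) \<rightarrow>\<^sub>M metric_borel W dW"
proof (rule measurable_sigma_sets[OF W.sets_metric_borel])
  have sp: "space (Pi\<^sub>M {..<n} (\<lambda>_. metric_borel Z dZ)) = (\<Pi>\<^sub>E i\<in>{..<n}. Z)"
    by (simp add: space_PiM space_metric_borel)
  have FW: "F (emp_measure Z dZ n z) \<in> W" if "z \<in> (\<Pi>\<^sub>E i\<in>{..<n}. Z)" for z
    by (intro F emp_measure_in_borel_probs n) (use that in auto)
  show "(\<lambda>z. F (emp_measure Z dZ n z)) \<in> space (Pi\<^sub>M {..<n} (\<lambda>_. metric_borel Z dZ)) \<rightarrow> W"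
    using FW unfolding sp by blast
  show "{U. openin W.mtopology U} \<subseteq> Pow W" using openin_subset by fastforce
  fix U assume "U \<in> {U. openin W.mtopology U}"
  then have U: "openin W.mtopology U" by simp
  let ?V = "(\<lambda>z. F (emp_measure Z dZ n z)) -` U \<inter> (\<Pi>\<^sub>E i\<in>{..<n}. Z)"
  have "?V \<in> sets (Pi\<^sub>M {..<n} (\<lambda>_. metric_borel Z dZ))"
  proof (rule Z.sets_PiM_metric_borel_openI[OF Z_tb])
    fix z assume z: "z \<in> ?V"
    then obtain r where r: "r > 0" "W.mball (F (emp_measure Z dZ n z)) r \<subseteq> U"
      using U by (force simp: W.openin_mtopology)
    then obtain \<delta> where \<delta>: "\<delta> > 0" "\<And>z z'. (\<forall>i<n. z i \<in> Z \<and> z' i \<in> Z \<and> dZ (z i) (z' i) < \<delta>) \<Longrightarrow>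
        dW (F (emp_measure Z dZ n z)) (F (emp_measure Z dZ n z')) < r"
      using uc unfolding sample_unif_cont_def by blast
    show "\<exists>\<delta>>0. \<forall>z'\<in>(\<Pi>\<^sub>E i\<in>{..<n}. Z). (\<forall>i<n. dZ (z i) (z' i) < \<delta>) \<longrightarrow> z' \<in> ?V"
    proof (intro exI[of _ \<delta>] conjI ballI impI)
      fix z' assume z': "z' \<in> (\<Pi>\<^sub>E i\<in>{..<n}. Z)" "\<forall>i<n. dZ (z i) (z' i) < \<delta>"
      have "dW (F (emp_measure Z dZ n z)) (F (emp_measure Z dZ n z')) < r"
        by (rule \<delta>(2)) (use z z' in auto)
      then have "F (emp_measure Z dZ n z') \<in> W.mball (F (emp_measure Z dZ n z)) r"
        using FW z z' by auto
      then show "z' \<in> ?V" using r z' by blast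
    qed (rule \<delta>)
  qed auto
  then show "(\<lambda>z. F (emp_measure Z dZ n z)) -` U \<inter> space (Pi\<^sub>M {..<n} (\<lambda>_. metric_borel Z dZ))
      \<in> sets (Pi\<^sub>M {..<n} (\<lambda>_. metric_borel Z dZ))"
    unfolding sp .
qed

lemma stat_law_in_borel_probs:
  assumes n: "0 < n" and F: "\<And>P. P \<in> borel_probs Z dZ \<Longrightarrow> F P \<in> W"
    and uc: "sample_unif_cont Z dZ dW n F" and P: "P \<in> borel_probs Z dZ"
  shows "stat_law Z dZ W dW F n P \<in> borel_probs W dW"
proof -
  interpret Pn: prob_space "Pi\<^sub>M {..<n} (\<lambda>_. P)"
    by (rule prob_space_PiM) (use Z.borel_probsD[OF P] in blast)
  have "prob_space (stat_law Z dZ W dW F n P)"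
    unfolding stat_law_def
    by (rule Pn.prob_space_distr)
       (rule measurable_PiM_sets_cong[OF Z.borel_probsD(2)[OF P] measurable_sample[OF n F uc]])
  then show ?thesis by (simp add: borel_probs_def stat_law_def)
qed

lemma integral_stat_law:
  assumes n: "0 < n" and F: "\<And>P. P \<in> borel_probs Z dZ \<Longrightarrow> F P \<in> W"
    and uc: "sample_unif_cont Z dZ dW n F" and P: "P \<in> borel_probs Z dZ"
    and f: "f \<in> borel_measurable (metric_borel W dW)"
  shows "integral\<^sup>L (stat_law Z dZ W dW F n P) f
    = (\<integral>z. f (F (emp_measure Z dZ n z)) \<partial>Pi\<^sub>M {..<n} (\<lambda>_. P) :: real)"
  unfolding stat_law_def
  by (rule integral_distr[OF _ f])
     (rule measurable_PiM_sets_cong[OF Z.borel_probsD(2)[OF P] measurable_sample[OF n F uc]])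

text \<open>Sampling from the empirical measure of \<open>z\<close> is drawing indices uniformly; using the same indices
  for \<open>z\<close> and \<open>z'\<close> couples the two resampling distributions.\<close>

lemma sample_unif_cont_stat_law:
  assumes n: "0 < n" and F: "\<And>P. P \<in> borel_probs Z dZ \<Longrightarrow> F P \<in> W"
    and uc: "sample_unif_cont Z dZ dW n F"
  shows "sample_unif_cont Z dZ (bl_dist W dW) n (stat_law Z dZ W dW F n)"
  unfolding sample_unif_cont_def
proof (intro allI impI)
  fix e :: real assume e: "e > 0"
  \<comment> \<open>\<open>bl_distI\<close> yields only a weak inequality; the half restores
    strictness at the end.\<close>
  then obtain \<delta> where \<delta>: "\<delta> > 0" "\<And>z z'. (\<forall>i<n. z i \<in> Z \<and> z' i \<in> Z \<and> dZ (z i) (z' i) < \<delta>) \<Longrightarrow>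
        dW (F (emp_measure Z dZ n z)) (F (emp_measure Z dZ n z')) < e / 2"
    using uc half_gt_zero[OF e] unfolding sample_unif_cont_def by blast
  define U where "U = uniform_count_measure {..<n}"
  interpret U: prob_space U
    unfolding U_def by (rule prob_space_uniform_count_measure) (use n in auto)
  interpret Un: prob_space "Pi\<^sub>M {..<n} (\<lambda>_. U)"
    by (rule prob_space_PiM) (rule U.prob_space_axioms)
  have spU: "space (Pi\<^sub>M {..<n} (\<lambda>_. U)) = (\<Pi>\<^sub>E i\<in>{..<n}. {..<n})"
    by (simp add: space_PiM U_def space_uniform_count_measure)
  note meas = measurable_sample[OF n F uc]
  \<comment> \<open>A resample from the atoms \<open>z\<close> is \<open>z\<close> composed with a
    uniform random index vector \<open>s\<close>. The laws for \<open>z\<close> and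
    \<open>z'\<close> thus become images of one probability space and can be compared pointwise in
    \<open>s\<close>.\<close>
  have law: "(\<lambda>s. F (emp_measure Z dZ n (compose {..<n} z s))) \<in> Pi\<^sub>M {..<n} (\<lambda>_. U) \<rightarrow>\<^sub>M metric_borel W dW"
      "stat_law Z dZ W dW F n (emp_measure Z dZ n z)
      = distr (Pi\<^sub>M {..<n} (\<lambda>_. U)) (metric_borel W dW) (\<lambda>s. F (emp_measure Z dZ n (compose {..<n} z s)))"
    if z: "\<And>i. i < n \<Longrightarrow> z i \<in> Z" for z
  proof -
    let ?E = "emp_measure Z dZ n z"
    have E: "?E \<in> borel_probs Z dZ" by (rule emp_measure_in_borel_probs[OF n z])
    interpret E: prob_space ?E using Z.borel_probsD[OF E] by blast
    have zm: "z \<in> U \<rightarrow>\<^sub>M ?E"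
      using z by (auto simp: measurable_def space_metric_borel space_uniform_count_measure
        sets_uniform_count_measure U_def Z.borel_probsD[OF E])
    have "distr U ?E z = ?E"
      using emp_measure_eq_distr[OF n z, where dZ=dZ] unfolding U_def
      by (subst distr_cong[OF refl sets_emp_measure refl]) simp_all
    then have PE: "distr (Pi\<^sub>M {..<n} (\<lambda>_. U)) (Pi\<^sub>M {..<n} (\<lambda>_. ?E)) (compose {..<n} z) = Pi\<^sub>M {..<n} (\<lambda>_. ?E)"
      by (subst distr_PiM_finite_prob_space)
         (auto simp: zm intro!: product_prob_spaceI U.prob_space_axioms E.prob_space_axioms)
    have cm: "compose {..<n} z \<in> Pi\<^sub>M {..<n} (\<lambda>_. U) \<rightarrow>\<^sub>M Pi\<^sub>M {..<n} (\<lambda>_. ?E)"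
      unfolding compose_def
      by (rule measurable_restrict, rule measurable_compose[OF _ zm], rule measurable_component_singleton)
    have m2: "(\<lambda>z. F (emp_measure Z dZ n z)) \<in> Pi\<^sub>M {..<n} (\<lambda>_. ?E) \<rightarrow>\<^sub>M metric_borel W dW"
      by (rule measurable_PiM_sets_cong[OF Z.borel_probsD(2)[OF E] meas])
    show "(\<lambda>s. F (emp_measure Z dZ n (compose {..<n} z s))) \<in> Pi\<^sub>M {..<n} (\<lambda>_. U) \<rightarrow>\<^sub>M metric_borel W dW"
      by (rule measurable_compose[OF cm m2])
    have "stat_law Z dZ W dW F n ?E = distr (distr (Pi\<^sub>M {..<n} (\<lambda>_. U)) (Pi\<^sub>M {..<n} (\<lambda>_. ?E)) (compose {..<n} z))
        (metric_borel W dW) (\<lambda>z. F (emp_measure Z dZ n z))"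
      unfolding stat_law_def PE ..
    also have "\<dots> = distr (Pi\<^sub>M {..<n} (\<lambda>_. U)) (metric_borel W dW) (\<lambda>s. F (emp_measure Z dZ n (compose {..<n} z s)))"
      by (subst distr_distr[OF m2 cm]) (simp add: comp_def)
    finally show "stat_law Z dZ W dW F n ?E = \<dots>" .
  qed
  show "\<exists>\<delta>>0. \<forall>z z'. (\<forall>i<n. z i \<in> Z \<and> z' i \<in> Z \<and> dZ (z i) (z' i) < \<delta>) \<longrightarrow>
     bl_dist W dW (stat_law Z dZ W dW F n (emp_measure Z dZ n z))
       (stat_law Z dZ W dW F n (emp_measure Z dZ n z')) < e"
  proof (intro exI[of _ \<delta>] conjI allI impI)
    fix z z' assume zz: "\<forall>i<n. z i \<in> Z \<and> z' i \<in> Z \<and> dZ (z i) (z' i) < \<delta>"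
    then have z: "\<And>i. i < n \<Longrightarrow> z i \<in> Z" and z': "\<And>i. i < n \<Longrightarrow> z' i \<in> Z" by auto
    have "bl_dist W dW (stat_law Z dZ W dW F n (emp_measure Z dZ n z))
       (stat_law Z dZ W dW F n (emp_measure Z dZ n z')) \<le> e / 2"
    proof (rule W.bl_distI)
      fix f :: "'w \<Rightarrow> real" assume f: "f \<in> borel_measurable (metric_borel W dW)" "\<And>x. x \<in> W \<Longrightarrow> \<bar>f x\<bar> \<le> 1"
        "\<And>x y. x \<in> W \<Longrightarrow> y \<in> W \<Longrightarrow> \<bar>f x - f y\<bar> \<le> dW x y"
      have cz: "emp_measure Z dZ n (compose {..<n} y s) \<in> borel_probs Z dZ"
        if "\<And>i. i < n \<Longrightarrow> y i \<in> Z" "s \<in> (\<Pi>\<^sub>E i\<in>{..<n}. {..<n})" for y and s :: "nat \<Rightarrow> nat"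
        by (rule emp_measure_in_borel_probs[OF n]) (use that in \<open>auto simp: compose_def\<close>)
      define g where "g y s = f (F (emp_measure Z dZ n (compose {..<n} y s)))" for y and s :: "nat \<Rightarrow> nat"
      have gm: "g y \<in> borel_measurable (Pi\<^sub>M {..<n} (\<lambda>_. U))" if "\<And>i. i < n \<Longrightarrow> y i \<in> Z" for y
        unfolding g_def by (rule measurable_compose[OF law(1)[of y, OF that] f(1)])
      have gi: "integrable (Pi\<^sub>M {..<n} (\<lambda>_. U)) (g y)" if y: "\<And>i. i < n \<Longrightarrow> y i \<in> Z" for y
      proof (rule Un.integrable_const_bound[of _ 1])
        show "AE s in Pi\<^sub>M {..<n} (\<lambda>_. U). norm (g y s) \<le> 1"
          using f(2) F cz[of y, OF y] by (intro AE_I2) (auto simp: g_def spU)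
      qed (use gm[of y, OF y] in auto)
      have eq: "integral\<^sup>L (stat_law Z dZ W dW F n (emp_measure Z dZ n y)) f = integral\<^sup>L (Pi\<^sub>M {..<n} (\<lambda>_. U)) (g y)"
        if y: "\<And>i. i < n \<Longrightarrow> y i \<in> Z" for y
        unfolding g_def by (subst law(2)[OF y], assumption) (rule integral_distr[OF law(1)[of y, OF y] f(1)])
      have le: "\<bar>g z s - g z' s\<bar> \<le> e / 2" if s: "s \<in> (\<Pi>\<^sub>E i\<in>{..<n}. {..<n})" for s
      proof -
        have "dW (F (emp_measure Z dZ n (compose {..<n} z s))) (F (emp_measure Z dZ n (compose {..<n} z' s))) < e / 2"
          by (rule \<delta>(2)) (use zz s in \<open>auto simp: compose_def\<close>)
        then show ?thesis
          using f(3) F[OF cz[of z, OF z s]] F[OF cz[of z', OF z' s]] unfolding g_def by (meson less_imp_le order_trans)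
      qed
      have "\<bar>integral\<^sup>L (Pi\<^sub>M {..<n} (\<lambda>_. U)) (g z) - integral\<^sup>L (Pi\<^sub>M {..<n} (\<lambda>_. U)) (g z')\<bar>
          = \<bar>\<integral>s. g z s - g z' s \<partial>Pi\<^sub>M {..<n} (\<lambda>_. U)\<bar>"
        using gi[of z, OF z] gi[of z', OF z'] by simp
      also have "\<dots> \<le> (\<integral>s. \<bar>g z s - g z' s\<bar> \<partial>Pi\<^sub>M {..<n} (\<lambda>_. U))"
        by (rule integral_abs_bound)
      also have "\<dots> \<le> e / 2"
        by (rule Un.integral_le_const) (use gi[of z, OF z] gi[of z', OF z'] le spU in auto)
      finally show "\<bar>integral\<^sup>L (stat_law Z dZ W dW F n (emp_measure Z dZ n z)) f
          - integral\<^sup>L (stat_law Z dZ W dW F n (emp_measure Z dZ n z')) f\<bar> \<le> e / 2"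
        using eq[of z, OF z] eq[of z', OF z'] by simp
    qed (use e in simp)
    then show "bl_dist W dW (stat_law Z dZ W dW F n (emp_measure Z dZ n z))
       (stat_law Z dZ W dW F n (emp_measure Z dZ n z')) < e" using e by linarith
  qed (rule \<delta>)
qed

text \<open>The total variation of the cell probabilities of a fine partition dominates the bounded
  Lipschitz distance, and its expectation is of order \<open>1 / sqrt n\<close> uniformly in the sampled
  distribution; hence the sampling distributions concentrate uniformly at the population value.\<close>

lemma asymp_equicont_stat_law:
  assumes F: "\<And>n P. P \<in> borel_probs Z dZ \<Longrightarrow> G n P \<in> W" "\<And>P. P \<in> borel_probs Z dZ \<Longrightarrow> G0 P \<in> W"
    and uc: "\<And>n. 0 < n \<Longrightarrow> sample_unif_cont Z dZ dW n (G n)"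
    and ae: "asymp_equicont Z dZ dW G G0"
  shows "asymp_equicont Z dZ (bl_dist W dW) (\<lambda>n. stat_law Z dZ W dW (G n) n)
    (\<lambda>Q. return (metric_borel W dW) (G0 Q))"
  unfolding asymp_equicont_def
proof (intro allI impI)
  fix e :: real assume e: "e > 0"
  then have "e / 8 > 0" by simp
  then obtain \<delta> n0 where \<delta>: "\<delta> > 0" "n0 \<ge> 1" and close:
    "\<And>n P Q. n \<ge> n0 \<Longrightarrow> P \<in> borel_probs Z dZ \<Longrightarrow> Q \<in> borel_probs Z dZ \<Longrightarrow> bl_dist Z dZ P Q < \<delta>
      \<Longrightarrow> dW (G n P) (G0 Q) < e / 8"
    using ae unfolding asymp_equicont_def by metis
  \<comment> \<open>With \<open>\<delta> / 4\<close> as cell radius the partition bound leaves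
    \<open>\<delta> / 2\<close> for the deviations of the cell probabilities.\<close>
  have "\<delta> / 4 > 0" using \<delta>(1) by simp
  from Z.finite_partition_bl_dist[OF Z_tb this] obtain N :: nat and A where
    NA: "(\<forall>j. A j \<in> sets (metric_borel Z dZ)) \<and>
    (\<forall>P\<in>borel_probs Z dZ. \<forall>Q\<in>borel_probs Z dZ.
      bl_dist Z dZ P Q \<le> 2 * (\<delta> / 4) + (\<Sum>j<N. \<bar>measure P (A j) - measure Q (A j)\<bar>))"
    by (elim exE)
  have A: "A j \<in> sets (metric_borel Z dZ)" for j using NA by blast
  have part: "bl_dist Z dZ P Q \<le> 2 * (\<delta> / 4) + (\<Sum>j<N. \<bar>measure P (A j) - measure Q (A j)\<bar>)"
    if "P \<in> borel_probs Z dZ" "Q \<in> borel_probs Z dZ" for P Q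
    using NA that by blast
  \<comment> \<open>\<open>C / sqrt n\<close> will bound the expectation of
    \<open>4 / \<delta> * D\<close>, the term charged in \<open>pt\<close> to samples whose
    empirical measure is far from \<open>P\<close>.\<close>
  define C where "C = 4 / \<delta> * real N"
  have "((\<lambda>n. C * (1 / sqrt (real n))) \<longlongrightarrow> C * 0) sequentially"
    by (intro tendsto_mult_left tendsto_divide_0[OF tendsto_const] filterlim_at_top_imp_at_infinity
        filterlim_compose[OF sqrt_at_top filterlim_real_sequentially])
  then have "\<forall>\<^sub>F n in sequentially. C * (1 / sqrt (real n)) < e / 8"
    using e by (intro order_tendstoD) auto
  then obtain n1 where n1: "\<And>n. n \<ge> n1 \<Longrightarrow> C * (1 / sqrt (real n)) < e / 8"
    unfolding eventually_sequentially by blast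
  show "\<exists>\<delta>>0. \<exists>n0\<ge>1. \<forall>n\<ge>n0. \<forall>P\<in>borel_probs Z dZ. \<forall>Q\<in>borel_probs Z dZ. bl_dist Z dZ P Q < \<delta> \<longrightarrow>
      bl_dist W dW (stat_law Z dZ W dW (G n) n P) (return (metric_borel W dW) (G0 Q)) < e"
  proof (rule exI[of _ \<delta>], intro conjI, rule \<delta>, rule exI[of _ "max n0 n1"], intro conjI allI impI ballI)
    show "1 \<le> max n0 n1" using \<delta> by simp
    fix n P Q assume "max n0 n1 \<le> n" and P: "P \<in> borel_probs Z dZ" and Q: "Q \<in> borel_probs Z dZ"
      and PQ: "bl_dist Z dZ P Q < \<delta>"
    then have n: "n \<ge> n0" "n \<ge> n1" "0 < n" using \<delta>(2) by auto
    interpret Pn: prob_space "Pi\<^sub>M {..<n} (\<lambda>_. P)"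
      by (rule prob_space_PiM) (use Z.borel_probsD[OF P] in blast)
    have spP: "space (Pi\<^sub>M {..<n} (\<lambda>_. P)) = (\<Pi>\<^sub>E i\<in>{..<n}. Z)"
      by (simp add: space_PiM Z.borel_probsD[OF P])
    define D where "D z = (\<Sum>j<N. \<bar>measure (emp_measure Z dZ n z) (A j) - measure P (A j)\<bar>)" for z
    note ED = Z.integral_abs_measure_emp_measure_diff_le[OF P A n(3)]
    have Dint: "integrable (Pi\<^sub>M {..<n} (\<lambda>_. P)) D"
      unfolding D_def using ED(1) by (intro Bochner_Integration.integrable_sum)
    have "integral\<^sup>L (Pi\<^sub>M {..<n} (\<lambda>_. P)) D
        = (\<Sum>j<N. \<integral>z. \<bar>measure (emp_measure Z dZ n z) (A j) - measure P (A j)\<bar> \<partial>Pi\<^sub>M {..<n} (\<lambda>_. P))"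
      unfolding D_def using ED(1) by (intro Bochner_Integration.integral_sum)
    also have "\<dots> \<le> (\<Sum>j<N. 1 / sqrt (real n))"
      by (intro sum_mono ED(2))
    finally have D_le: "integral\<^sup>L (Pi\<^sub>M {..<n} (\<lambda>_. P)) D \<le> real N * (1 / sqrt (real n))" by simp
    have PP: "bl_dist Z dZ P P < \<delta>"
      using Metric_space.zero[OF Z.Metric_space_bl_dist P P] \<delta>(1) by simp
    \<comment> \<open>\<open>G n P\<close> is close to both limits, which yields the continuity of
      \<open>G0\<close> as a by-product.\<close>
    have G0: "dW (G0 P) (G0 Q) \<le> e / 4"
      using close[OF n(1) P P PP] close[OF n(1) P Q PQ]
        W.triangle''[of "G0 P" "G n P" "G0 Q"] F(1)[OF P] F(2)[OF P] F(2)[OF Q] by fastforce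
    have "bl_dist W dW (stat_law Z dZ W dW (G n) n P) (return (metric_borel W dW) (G0 Q)) \<le> e / 2"
    proof (rule W.bl_distI)
      fix f :: "'w \<Rightarrow> real" assume f: "f \<in> borel_measurable (metric_borel W dW)" "\<And>x. x \<in> W \<Longrightarrow> \<bar>f x\<bar> \<le> 1"
        "\<And>x y. x \<in> W \<Longrightarrow> y \<in> W \<Longrightarrow> \<bar>f x - f y\<bar> \<le> dW x y"
      define g where "g z = f (G n (emp_measure Z dZ n z))" for z
      have emp: "emp_measure Z dZ n z \<in> borel_probs Z dZ" if "z \<in> (\<Pi>\<^sub>E i\<in>{..<n}. Z)" for z
        by (rule emp_measure_in_borel_probs[OF n(3)]) (use that in auto)
      have gm: "g \<in> borel_measurable (Pi\<^sub>M {..<n} (\<lambda>_. P))"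
        unfolding g_def
        by (rule measurable_compose[OF _ f(1)])
           (rule measurable_PiM_sets_cong[OF Z.borel_probsD(2)[OF P] measurable_sample[OF n(3) F(1) uc[OF n(3)]]])
      have gi: "integrable (Pi\<^sub>M {..<n} (\<lambda>_. P)) g"
        by (rule Pn.integrable_const_bound[of _ 1])
           (use gm f(2) F(1) emp in \<open>auto simp: g_def spP intro!: AE_I2\<close>)
      \<comment> \<open>Markov's inequality in pointwise form. If \<open>D z < \<delta> / 2\<close>,
        the empirical measure is within \<open>\<delta>\<close> of \<open>P\<close> and
        \<open>e / 8\<close> suffices; otherwise \<open>4 / \<delta> * D z\<close> is at least 2,
        the trivial bound for a difference of values of \<open>f\<close>.\<close>
      have pt: "\<bar>g z - f (G0 P)\<bar> \<le> e / 8 + 4 / \<delta> * D z" if z: "z \<in> (\<Pi>\<^sub>E i\<in>{..<n}. Z)" for z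
      proof (cases "D z < \<delta> / 2")
        case True
        then have "bl_dist Z dZ (emp_measure Z dZ n z) P < \<delta>"
          using part[OF emp[OF z] P] unfolding D_def by linarith
        then have "dW (G n (emp_measure Z dZ n z)) (G0 P) < e / 8"
          by (rule close[OF n(1) emp[OF z] P])
        moreover have "\<bar>g z - f (G0 P)\<bar> \<le> dW (G n (emp_measure Z dZ n z)) (G0 P)"
          unfolding g_def by (intro f(3) F emp[OF z] P)
        moreover have "0 \<le> 4 / \<delta> * D z" unfolding D_def using \<delta>(1) by (auto intro!: sum_nonneg mult_nonneg_nonneg)
        ultimately show ?thesis by linarith
      next
        case False
        then have "2 \<le> 4 / \<delta> * D z" using \<delta>(1) by (simp add: field_simps)
        moreover have "\<bar>g z\<bar> \<le> 1" "\<bar>f (G0 P)\<bar> \<le> 1"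
          unfolding g_def using f(2) F emp[OF z] P by blast+
        ultimately show ?thesis using e by linarith
      qed
      have int: "integrable (Pi\<^sub>M {..<n} (\<lambda>_. P)) (\<lambda>z. e / 8 + 4 / \<delta> * D z)"
        using Dint by simp
      have "\<bar>integral\<^sup>L (Pi\<^sub>M {..<n} (\<lambda>_. P)) g - f (G0 P)\<bar> = \<bar>\<integral>z. g z - f (G0 P) \<partial>Pi\<^sub>M {..<n} (\<lambda>_. P)\<bar>"
        using gi by (simp add: Pn.prob_space)
      also have "\<dots> \<le> (\<integral>z. \<bar>g z - f (G0 P)\<bar> \<partial>Pi\<^sub>M {..<n} (\<lambda>_. P))"
        by (rule integral_abs_bound)
      also have "\<dots> \<le> (\<integral>z. e / 8 + 4 / \<delta> * D z \<partial>Pi\<^sub>M {..<n} (\<lambda>_. P))"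
        by (rule integral_mono[OF _ int]) (use gi pt spP in auto)
      also have "\<dots> = e / 8 + 4 / \<delta> * integral\<^sup>L (Pi\<^sub>M {..<n} (\<lambda>_. P)) D"
        using Dint by (simp add: Pn.prob_space)
      also have "\<dots> \<le> e / 8 + 4 / \<delta> * (real N * (1 / sqrt (real n)))"
        by (intro add_left_mono mult_left_mono D_le) (use \<delta> in auto)
      also have "\<dots> \<le> e / 4"
        using n1[OF n(2)] unfolding C_def by (simp add: mult.assoc)
      finally have "\<bar>integral\<^sup>L (Pi\<^sub>M {..<n} (\<lambda>_. P)) g - f (G0 P)\<bar> \<le> e / 4" .
      moreover have "\<bar>f (G0 P) - f (G0 Q)\<bar> \<le> e / 4"
        using f(3)[OF F(2)[OF P] F(2)[OF Q]] G0 by linarith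
      moreover have "integral\<^sup>L (return (metric_borel W dW) (G0 Q)) f = f (G0 Q)"
        using F(2)[OF Q] f(1) by (intro integral_return) (auto simp: space_metric_borel)
      moreover have "integral\<^sup>L (stat_law Z dZ W dW (G n) n P) f = integral\<^sup>L (Pi\<^sub>M {..<n} (\<lambda>_. P)) g"
        unfolding g_def by (rule integral_stat_law[OF n(3) F(1) uc[OF n(3)] P f(1)])
      ultimately show "\<bar>integral\<^sup>L (stat_law Z dZ W dW (G n) n P) f
          - integral\<^sup>L (return (metric_borel W dW) (G0 Q)) f\<bar> \<le> e / 2"
        by linarith
    qed (use e in simp)
    then show "bl_dist W dW (stat_law Z dZ W dW (G n) n P) (return (metric_borel W dW) (G0 Q)) < e"
      using e by linarith
  qed
qed

text \<open>Both bootstrap laws lie near one fixed point, the Dirac measure at the Dirac measure at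
  \<open>T P\<close>: equicontinuity at the second level applies to \<open>Q\<close> near
  \<open>P\<close> as well as to \<open>P\<close> itself. The two laws are compared only through
  this point.\<close>

theorem bootstrap_qualitatively_robust_atI:
  assumes T: "\<And>P. P \<in> borel_probs Z dZ \<Longrightarrow> T P \<in> W"
    and uc: "\<And>e. 0 < e \<Longrightarrow> \<exists>\<delta>>0. \<forall>P\<in>borel_probs Z dZ. \<forall>Q\<in>borel_probs Z dZ.
      bl_dist Z dZ P Q < \<delta> \<longrightarrow> dW (T P) (T Q) < e"
    and P: "P \<in> borel_probs Z dZ"
  shows "bootstrap_qualitatively_robust_at Z dZ W dW T P"
proof -
  interpret W1: Metric_space "borel_probs W dW" "bl_dist W dW"
    by (rule W.Metric_space_bl_dist)
  interpret W2: Metric_space "borel_probs (borel_probs W dW) (bl_dist W dW)"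
    "bl_dist (borel_probs W dW) (bl_dist W dW)"
    by (rule W1.Metric_space_bl_dist)
  interpret ZW1: two_metrics Z dZ "borel_probs W dW" "bl_dist W dW"
    by unfold_locales (rule Z_tb)
  have retW: "return (metric_borel W dW) (T Q) \<in> borel_probs W dW" if "Q \<in> borel_probs Z dZ" for Q
    using T[OF that] by (auto simp: borel_probs_def space_metric_borel intro!: prob_space_return)
  have ret1: "return (metric_borel (borel_probs W dW) (bl_dist W dW)) (return (metric_borel W dW) (T P))
      \<in> borel_probs (borel_probs W dW) (bl_dist W dW)"
    using retW[OF P] by (auto simp: borel_probs_def[of "borel_probs W dW"] space_metric_borel intro!: prob_space_return)
  have suc: "sample_unif_cont Z dZ dW n T" if n: "0 < n" for n
    unfolding sample_unif_cont_def
  proof (intro allI impI)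
    fix e :: real assume "e > 0"
    then obtain \<delta> where \<delta>: "\<delta> > 0" "\<And>P Q. P \<in> borel_probs Z dZ \<Longrightarrow> Q \<in> borel_probs Z dZ \<Longrightarrow>
        bl_dist Z dZ P Q < \<delta> \<Longrightarrow> dW (T P) (T Q) < e"
      using uc by metis
    show "\<exists>\<delta>>0. \<forall>z z'. (\<forall>i<n. z i \<in> Z \<and> z' i \<in> Z \<and> dZ (z i) (z' i) < \<delta>) \<longrightarrow>
        dW (T (emp_measure Z dZ n z)) (T (emp_measure Z dZ n z')) < e"
    proof (intro exI[of _ "\<delta> / 2"] conjI allI impI \<delta>(2))
      fix z z' assume z: "\<forall>i<n. z i \<in> Z \<and> z' i \<in> Z \<and> dZ (z i) (z' i) < \<delta> / 2"
      have "bl_dist Z dZ (emp_measure Z dZ n z) (emp_measure Z dZ n z') \<le> \<delta> / 2"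
        by (rule Z.bl_dist_emp_measure_le[OF n]) (use z in \<open>auto intro: less_imp_le\<close>)
      then show "bl_dist Z dZ (emp_measure Z dZ n z) (emp_measure Z dZ n z') < \<delta>"
        using \<delta>(1) by linarith
    qed (use \<delta>(1) n in \<open>auto intro!: emp_measure_in_borel_probs\<close>)
  qed
  have ae: "asymp_equicont Z dZ dW (\<lambda>_. T) T"
    unfolding asymp_equicont_def using uc by (meson order_refl)
  have ae1: "asymp_equicont Z dZ (bl_dist W dW) (stat_law Z dZ W dW T)
      (\<lambda>Q. return (metric_borel W dW) (T Q))"
    using asymp_equicont_stat_law[of "\<lambda>_. T" T] T suc ae by blast
  \<comment> \<open>The sampling law for \<open>n = 0\<close> may be junk, since the empirical measure of no points is zero.\<close>
  define G where "G n = (if n = 0 then \<lambda>Q. return (metric_borel W dW) (T Q) else stat_law Z dZ W dW T n)" for n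
  have GW: "G n Q \<in> borel_probs W dW" if "Q \<in> borel_probs Z dZ" for n Q
    using retW[OF that] stat_law_in_borel_probs[OF _ T suc that] by (auto simp: G_def)
  have G_suc: "sample_unif_cont Z dZ (bl_dist W dW) n (G n)" if "0 < n" for n
    using sample_unif_cont_stat_law[OF that T suc[OF that]] that by (simp add: G_def)
  have G_ae: "asymp_equicont Z dZ (bl_dist W dW) G (\<lambda>Q. return (metric_borel W dW) (T Q))"
    unfolding asymp_equicont_def
  proof (intro allI impI)
    fix e :: real assume "e > 0"
    then obtain \<delta> n0 where *: "\<delta> > 0" "n0 \<ge> 1" "\<forall>n\<ge>n0. \<forall>P\<in>borel_probs Z dZ. \<forall>Q\<in>borel_probs Z dZ.
        bl_dist Z dZ P Q < \<delta> \<longrightarrow>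
        bl_dist W dW (stat_law Z dZ W dW T n P) (return (metric_borel W dW) (T Q)) < e"
      using ae1 unfolding asymp_equicont_def by meson
    moreover have "G n = stat_law Z dZ W dW T n" if "n \<ge> n0" for n
      using that *(2) by (simp add: G_def)
    ultimately show "\<exists>\<delta>>0. \<exists>n0\<ge>1. \<forall>n\<ge>n0. \<forall>P\<in>borel_probs Z dZ. \<forall>Q\<in>borel_probs Z dZ.
        bl_dist Z dZ P Q < \<delta> \<longrightarrow> bl_dist W dW (G n P) (return (metric_borel W dW) (T Q)) < e"
      by (intro exI[of _ \<delta>] conjI exI[of _ n0]) simp_all
  qed
  \<comment> \<open>The outer sampling is an instance of \<open>stat_law\<close> whose statistic
    \<open>G n\<close> is itself a sampling law.\<close>
  have boot: "bootstrap_law Z dZ W dW T n Q = stat_law Z dZ (borel_probs W dW) (bl_dist W dW) (G n) n Q"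
    if "0 < n" for n Q
    using that by (simp add: bootstrap_law_def stat_law_def[of Z dZ "borel_probs W dW"] G_def)
  have bootW: "bootstrap_law Z dZ W dW T n Q \<in> borel_probs (borel_probs W dW) (bl_dist W dW)"
    if "0 < n" "Q \<in> borel_probs Z dZ" for n Q
    unfolding boot[OF that(1)] by (rule ZW1.stat_law_in_borel_probs[OF that(1) GW G_suc[OF that(1)] that(2)])
  have ae2: "asymp_equicont Z dZ (bl_dist (borel_probs W dW) (bl_dist W dW))
     (\<lambda>n. stat_law Z dZ (borel_probs W dW) (bl_dist W dW) (G n) n)
     (\<lambda>Q. return (metric_borel (borel_probs W dW) (bl_dist W dW)) (return (metric_borel W dW) (T Q)))"
    by (rule ZW1.asymp_equicont_stat_law[OF GW retW G_suc G_ae])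
  show ?thesis
    unfolding bootstrap_qualitatively_robust_at_def
  proof (intro allI impI)
    fix e :: real assume e: "e > 0"
    define R where "R = return (metric_borel (borel_probs W dW) (bl_dist W dW)) (return (metric_borel W dW) (T P))"
    \<comment> \<open>Two distances below \<open>e / 3\<close> give the bound
      \<open>2 * e / 3\<close> for every \<open>n\<close>, which stays strictly below
      \<open>e\<close> after taking the supremum.\<close>
    have "e / 3 > 0" using e by simp
    then obtain \<delta> n0 where \<delta>: "\<delta> > 0" "n0 \<ge> 1" and close:
      "\<And>n Q. n \<ge> n0 \<Longrightarrow> Q \<in> borel_probs Z dZ \<Longrightarrow> bl_dist Z dZ Q P < \<delta> \<Longrightarrow>
        bl_dist (borel_probs W dW) (bl_dist W dW)
          (stat_law Z dZ (borel_probs W dW) (bl_dist W dW) (G n) n Q) R < e / 3"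
      using ae2 P unfolding asymp_equicont_def R_def by metis
    show "\<exists>\<delta>>0. \<exists>n0\<ge>1. \<forall>Q\<in>borel_probs Z dZ. bl_dist Z dZ Q P < \<delta> \<longrightarrow>
        (SUP n\<in>{n0..}. bl_dist (borel_probs W dW) (bl_dist W dW)
           (bootstrap_law Z dZ W dW T n Q) (bootstrap_law Z dZ W dW T n P)) < e"
    proof (rule exI[of _ \<delta>], intro conjI, rule \<delta>, rule exI[of _ n0], intro conjI ballI impI, rule \<delta>)
      fix Q assume Q: "Q \<in> borel_probs Z dZ" "bl_dist Z dZ Q P < \<delta>"
      have PP: "bl_dist Z dZ P P < \<delta>"
        using Metric_space.zero[OF Z.Metric_space_bl_dist P P] \<delta>(1) by simp
      have "(SUP n\<in>{n0..}. bl_dist (borel_probs W dW) (bl_dist W dW)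
           (bootstrap_law Z dZ W dW T n Q) (bootstrap_law Z dZ W dW T n P)) \<le> 2 * e / 3"
      proof (rule cSUP_least)
        fix n assume "n \<in> {n0..}"
        then have n: "n \<ge> n0" "0 < n" using \<delta>(2) by auto
        show "bl_dist (borel_probs W dW) (bl_dist W dW)
           (bootstrap_law Z dZ W dW T n Q) (bootstrap_law Z dZ W dW T n P) \<le> 2 * e / 3"
          using W2.triangle'[OF bootW[OF n(2) Q(1)] ret1 bootW[OF n(2) P]]
            close[OF n(1) Q] close[OF n(1) P PP] boot[OF n(2)]
          unfolding R_def by simp
      qed simp
      then show "(SUP n\<in>{n0..}. bl_dist (borel_probs W dW) (bl_dist W dW)
           (bootstrap_law Z dZ W dW T n Q) (bootstrap_law Z dZ W dW T n P)) < e"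
        using e by linarith
    qed
  qed
qed

end

section \<open>Equicontinuous test functions\<close>

context Metric_space
begin

text \<open>Cover the space by open sets of \<open>E\<close>-radius \<open>e / 2\<close>. Points
  closer than a Lebesgue number share a member of the cover, and the triangle inequality through its
  centre gives \<open>e\<close>. It is meant for pseudometrics \<open>E\<close> that are continuous
  but come with no explicit modulus in terms of \<open>d\<close>.\<close>

lemma compact_uniformly_small:
  assumes cpt: "compact_space mtopology"
    and sym: "\<And>x y. x \<in> M \<Longrightarrow> y \<in> M \<Longrightarrow> E x y = E y x"
    and tri: "\<And>x y z. x \<in> M \<Longrightarrow> y \<in> M \<Longrightarrow> z \<in> M \<Longrightarrow> E x z \<le> E x y + E y z"
    and nbhd: "\<And>x e. x \<in> M \<Longrightarrow> 0 < e \<Longrightarrow> \<exists>U. openin mtopology U \<and> x \<in> U \<and> (\<forall>y\<in>U. E x y < e)"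
    and e: "0 < (e :: real)"
  shows "\<exists>\<delta>>0. \<forall>x\<in>M. \<forall>y\<in>M. d x y < \<delta> \<longrightarrow> E x y < e"
proof -
  define C where "C = {U. openin mtopology U \<and> (\<exists>x\<in>M. \<forall>y\<in>U. E x y < e / 2)}"
  have "M \<subseteq> \<Union>C"
  proof
    fix x assume x: "x \<in> M"
    obtain U where "openin mtopology U" "x \<in> U" "\<forall>y\<in>U. E x y < e / 2"
      using nbhd[OF x, of "e / 2"] e by auto
    then show "x \<in> \<Union>C" using x unfolding C_def by blast
  qed
  moreover have "compactin mtopology M" using cpt by (simp add: compact_space_def)
  ultimately obtain \<delta> where \<delta>: "\<delta> > 0" "\<forall>x\<in>M. \<exists>U\<in>C. mball x \<delta> \<subseteq> U"
    using lebesgue_number[of M C] unfolding C_def by blast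
  have "E x y < e" if x: "x \<in> M" and y: "y \<in> M" and xy: "d x y < \<delta>" for x y
  proof -
    obtain U c where U: "mball x \<delta> \<subseteq> U" and c: "c \<in> M" "\<forall>y\<in>U. E c y < e / 2"
      using \<delta>(2) x unfolding C_def by blast
    have "x \<in> U" "y \<in> U" using U x y xy \<delta>(1) by (auto simp: subset_iff)
    then have "E c x < e / 2" "E c y < e / 2" using c by auto
    then show ?thesis using tri[OF x c(1) y] sym[OF x c(1)] by linarith
  qed
  then show ?thesis using \<delta>(1) by blast
qed

text \<open>The infimal convolution of \<open>h\<close> with a steep multiple of the distance is a Lipschitz
  approximation of \<open>h\<close> whose quality and constant depend only on the modulus of continuity.\<close>

lemma lipschitz_approximation:
  fixes h :: "'a \<Rightarrow> real"
  assumes bd: "\<And>x. x \<in> M \<Longrightarrow> \<bar>h x\<bar> \<le> B" and B: "0 \<le> B" and \<delta>: "0 < \<delta>" and \<eta>: "0 \<le> \<eta>"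
    and uc: "\<And>x y. x \<in> M \<Longrightarrow> y \<in> M \<Longrightarrow> d x y < \<delta> \<Longrightarrow> \<bar>h x - h y\<bar> \<le> \<eta>"
  obtains g where "\<And>x. x \<in> M \<Longrightarrow> \<bar>g x\<bar> \<le> B" "\<And>x. x \<in> M \<Longrightarrow> \<bar>h x - g x\<bar> \<le> \<eta>"
    "\<And>x y. x \<in> M \<Longrightarrow> y \<in> M \<Longrightarrow> \<bar>g x - g y\<bar> \<le> (2 * B / \<delta>) * d x y"
proof -
  \<comment> \<open>At distance at least \<open>\<delta>\<close> the penalty is at least
    \<open>m * \<delta> = 2 * B\<close>, the largest possible oscillation of \<open>h\<close>; so
    far points cannot push the infimum below \<open>h x\<close>, and near ones do so by at most
    \<open>\<eta>\<close>.\<close>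
  define m where "m = 2 * B / \<delta>"
  have m: "0 \<le> m" using B \<delta> by (simp add: m_def)
  define g where "g x = (INF y\<in>M. h y + m * d x y)" for x
  have md: "0 \<le> m * d x y" for x y using m by simp
  have "- B \<le> h y + m * d x y" if "y \<in> M" for x y
    using bd[OF that] md[of x y] by linarith
  then have bdd: "bdd_below ((\<lambda>y. h y + m * d x y) ` M)" for x
    by (rule bdd_belowI2)
  have upper: "g x \<le> h y + m * d x y" if "y \<in> M" for x y
    unfolding g_def by (rule cINF_lower[OF bdd that])
  have lower: "c \<le> g x" if "x \<in> M" "\<And>y. y \<in> M \<Longrightarrow> c \<le> h y + m * d x y" for c x
    unfolding g_def by (rule cINF_greatest) (use that in auto)
  have le: "g x \<le> h x" if "x \<in> M" for x using upper[OF that, of x] that by simp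
  show ?thesis
  proof (rule that[of g])
    fix x assume x: "x \<in> M"
    have "- B \<le> g x"
    proof (rule lower[OF x])
      fix y assume "y \<in> M"
      then show "- B \<le> h y + m * d x y" using bd[of y] md[of x y] by linarith
    qed
    then show "\<bar>g x\<bar> \<le> B" using le[OF x] bd[OF x] by linarith
    have "h x - \<eta> \<le> g x"
    proof (rule lower[OF x])
      fix y assume y: "y \<in> M"
      show "h x - \<eta> \<le> h y + m * d x y"
      proof (cases "d x y < \<delta>")
        case True
        then show ?thesis using uc[OF x y True] md[of x y] by linarith
      next
        case False
        then have "m * \<delta> \<le> m * d x y" using m by (intro mult_left_mono) auto
        then have "2 * B \<le> m * d x y" using \<delta> by (simp add: m_def)
        then show ?thesis using bd[OF x] bd[OF y] \<eta> by linarith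
      qed
    qed
    then show "\<bar>h x - g x\<bar> \<le> \<eta>" using le[OF x] by linarith
  next
    have step: "g x \<le> g y + m * d x y" if x: "x \<in> M" and y: "y \<in> M" for x y
    proof -
      have "g x - m * d x y \<le> g y"
      proof (rule lower[OF y])
        fix c assume c: "c \<in> M"
        have "m * d x c \<le> m * (d x y + d y c)" by (intro mult_left_mono triangle x y c m)
        then show "g x - m * d x y \<le> h c + m * d y c"
          using upper[OF c, of x] by (simp add: distrib_left)
      qed
      then show ?thesis by simp
    qed
    fix x y assume "x \<in> M" "y \<in> M"
    then show "\<bar>g x - g y\<bar> \<le> (2 * B / \<delta>) * d x y"
      using step[of x y] step[of y x] commute[of x y] unfolding m_def by auto
  qed
qed

text \<open>\<open>bl_dist\<close> controls Lipschitz functions only. Equicontinuity gives all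
  members of \<open>F\<close> Lipschitz approximations with a common bound \<open>C\<close> and a
  common constant \<open>m\<close>, so one threshold serves the family: \<open>e / 4\<close> for the
  approximation under each measure and \<open>e / 4\<close> for the integrals of the
  approximant.\<close>

lemma equicontinuous_integral_diff:
  fixes F :: "('a \<Rightarrow> real) set"
  assumes bd: "\<And>h x. h \<in> F \<Longrightarrow> x \<in> M \<Longrightarrow> \<bar>h x\<bar> \<le> B"
    and ec: "\<And>e. 0 < e \<Longrightarrow> \<exists>\<delta>>0. \<forall>h\<in>F. \<forall>x\<in>M. \<forall>y\<in>M. d x y < \<delta> \<longrightarrow> \<bar>h x - h y\<bar> < e"
    and e: "0 < e"
  shows "\<exists>\<delta>>0. \<forall>P\<in>borel_probs M d. \<forall>Q\<in>borel_probs M d. bl_dist M d P Q < \<delta> \<longrightarrow>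
    (\<forall>h\<in>F. \<bar>integral\<^sup>L P h - integral\<^sup>L Q h\<bar> < e)"
proof -
  \<comment> \<open>\<open>B\<close> may be nonpositive; the maximum with 1 keeps
    \<open>C + m\<close> positive.\<close>
  define C where "C = max B 1"
  have C: "C > 0" "\<And>h x. h \<in> F \<Longrightarrow> x \<in> M \<Longrightarrow> \<bar>h x\<bar> \<le> C"
    using bd by (auto simp: C_def intro: le_max_iff_disj[THEN iffD2])
  obtain \<delta> where \<delta>: "\<delta> > 0" "\<And>h x y. h \<in> F \<Longrightarrow> x \<in> M \<Longrightarrow> y \<in> M \<Longrightarrow> d x y < \<delta> \<Longrightarrow> \<bar>h x - h y\<bar> < e / 4"
    using ec[of "e / 4"] e by auto
  define m where "m = 2 * C / \<delta>"
  have m: "m \<ge> 0" using C \<delta> by (simp add: m_def)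
  have "\<bar>integral\<^sup>L P h - integral\<^sup>L Q h\<bar> < e"
    if P: "P \<in> borel_probs M d" and Q: "Q \<in> borel_probs M d"
      and PQ: "bl_dist M d P Q < e / (4 * (C + m))" and h: "h \<in> F" for P Q h
  proof -
    obtain g where g: "\<And>x. x \<in> M \<Longrightarrow> \<bar>g x\<bar> \<le> C" "\<And>x. x \<in> M \<Longrightarrow> \<bar>h x - g x\<bar> \<le> e / 4"
      "\<And>x y. x \<in> M \<Longrightarrow> y \<in> M \<Longrightarrow> \<bar>g x - g y\<bar> \<le> m * d x y"
      unfolding m_def
      by (rule lipschitz_approximation[of h C \<delta> "e / 4"]) (use C \<delta> h e in \<open>auto intro: less_imp_le\<close>)
    have hm: "h \<in> borel_measurable (metric_borel M d)"
      by (rule borel_measurable_metric_borelI) (use ec h in meson)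
    have gm: "g \<in> borel_measurable (metric_borel M d)"
      by (rule borel_measurable_metric_borel_lipschitz[OF g(3)])
    have app: "\<bar>integral\<^sup>L R h - integral\<^sup>L R g\<bar> \<le> e / 4" if R: "R \<in> borel_probs M d" for R
    proof -
      have "integrable R h" "integrable R g"
        using integrable_borel_probs[OF R hm C(2)[OF h]] integrable_borel_probs[OF R gm g(1)] by auto
      then have "integral\<^sup>L R h - integral\<^sup>L R g = integral\<^sup>L R (\<lambda>x. h x - g x)" by simp
      then show ?thesis
        using abs_integral_borel_probs_le[OF R _ g(2)] hm gm by simp
    qed
    have "\<bar>integral\<^sup>L P g - integral\<^sup>L Q g\<bar> \<le> (C + m) * bl_dist M d P Q"
      by (rule abs_integral_diff_le_bl_dist[OF P Q g(1) g(3) m])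
    also have "\<dots> < e / 4"
      using PQ C(1) m by (simp add: field_simps)
    finally show ?thesis using app[OF P] app[OF Q] by linarith
  qed
  moreover have "e / (4 * (C + m)) > 0" using C(1) m e by simp
  ultimately show ?thesis by blast
qed

end

section \<open>Hilbert spaces of functions\<close>

locale function_hilbert_space =
  fixes X :: "'x set" and H :: "('x \<Rightarrow> real) set" and ip :: "('x \<Rightarrow> real) \<Rightarrow> ('x \<Rightarrow> real) \<Rightarrow> real"
  assumes hilbert: "hilbert_function_space X H ip"
begin

text \<open>Names for the restricted functions in \<open>hilbert_function_space_def\<close>, so that
  the simplifier can use bilinearity of \<open>ip\<close> without looking into them.\<close>

definition plus_fun where "plus_fun f g = (\<lambda>x\<in>X. f x + g x :: real)"
definition scale_fun where "scale_fun c f = (\<lambda>x\<in>X. c * f x :: real)"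
definition diff_fun where "diff_fun f g = (\<lambda>x\<in>X. f x - g x :: real)"
definition norm_fun where "norm_fun f = sqrt (ip f f)"

lemma zero_in: "(\<lambda>x\<in>X. 0) \<in> H"
  and plus_in [simp]: "f \<in> H \<Longrightarrow> g \<in> H \<Longrightarrow> plus_fun f g \<in> H"
  and scale_in [simp]: "f \<in> H \<Longrightarrow> scale_fun c f \<in> H"
  and ip_commute: "f \<in> H \<Longrightarrow> g \<in> H \<Longrightarrow> ip f g = ip g f"
  and ip_plus_left [simp]: "f \<in> H \<Longrightarrow> g \<in> H \<Longrightarrow> h \<in> H \<Longrightarrow> ip (plus_fun f g) h = ip f h + ip g h"
  and ip_scale_left [simp]: "f \<in> H \<Longrightarrow> g \<in> H \<Longrightarrow> ip (scale_fun c f) g = c * ip f g"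
  and ip_nonneg: "f \<in> H \<Longrightarrow> 0 \<le> ip f f"
  and ip_zeroD: "f \<in> H \<Longrightarrow> ip f f = 0 \<Longrightarrow> f = (\<lambda>x\<in>X. 0)"
  and in_extensional: "f \<in> H \<Longrightarrow> f \<in> extensional X"
  and complete: "Metric_space.mcomplete H (ip_dist X H ip)"
  using hilbert unfolding hilbert_function_space_def plus_fun_def scale_fun_def by blast+

lemma ip_plus_right [simp]: "f \<in> H \<Longrightarrow> g \<in> H \<Longrightarrow> h \<in> H \<Longrightarrow> ip h (plus_fun f g) = ip h f + ip h g"
  by (simp add: ip_commute[of h])

lemma ip_scale_right [simp]: "f \<in> H \<Longrightarrow> g \<in> H \<Longrightarrow> ip g (scale_fun c f) = c * ip g f"
  by (simp add: ip_commute[of g])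

lemma diff_fun_eq: "diff_fun f g = plus_fun f (scale_fun (- 1) g)"
  by (auto simp: diff_fun_def plus_fun_def scale_fun_def)

lemma diff_in [simp]: "f \<in> H \<Longrightarrow> g \<in> H \<Longrightarrow> diff_fun f g \<in> H"
  by (simp add: diff_fun_eq)

lemma ip_diff_left [simp]: "f \<in> H \<Longrightarrow> g \<in> H \<Longrightarrow> h \<in> H \<Longrightarrow> ip (diff_fun f g) h = ip f h - ip g h"
  by (simp add: diff_fun_eq)

lemma ip_diff_right [simp]: "f \<in> H \<Longrightarrow> g \<in> H \<Longrightarrow> h \<in> H \<Longrightarrow> ip h (diff_fun f g) = ip h f - ip h g"
  by (simp add: diff_fun_eq)

lemma ip_zero_left: "f \<in> H \<Longrightarrow> ip (\<lambda>x\<in>X. 0) f = 0"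
  using ip_scale_left[of f f 0] by (simp add: scale_fun_def)

lemma norm_fun_nonneg: "f \<in> H \<Longrightarrow> 0 \<le> norm_fun f"
  by (simp add: norm_fun_def ip_nonneg)

lemma norm_fun_power2: "f \<in> H \<Longrightarrow> (norm_fun f)\<^sup>2 = ip f f"
  by (simp add: norm_fun_def ip_nonneg)

lemma cauchy_schwarz:
  assumes f: "f \<in> H" and g: "g \<in> H"
  shows "\<bar>ip f g\<bar> \<le> norm_fun f * norm_fun g"
proof (cases "ip g g = 0")
  case True
  then show ?thesis
    using ip_zeroD[OF g True] ip_zero_left[OF f] ip_commute[OF f g] ip_nonneg f g
    by (simp add: norm_fun_def)
next
  case False
  then have pos: "ip g g > 0" using ip_nonneg[OF g] by linarith
  \<comment> \<open>The vector is \<open>ip g g\<close> times the residual of the projection of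
    \<open>f\<close> onto \<open>g\<close>; the scaling avoids division.\<close>
  have "0 \<le> ip (diff_fun (scale_fun (ip g g) f) (scale_fun (ip f g) g))
               (diff_fun (scale_fun (ip g g) f) (scale_fun (ip f g) g))"
    by (rule ip_nonneg) (use f g in simp)
  also have "\<dots> = ip g g * (ip f f * ip g g - (ip f g)\<^sup>2)"
    using f g ip_commute[OF g f] by (simp add: algebra_simps power2_eq_square)
  finally have "(ip f g)\<^sup>2 \<le> ip f f * ip g g"
    using pos by (simp add: zero_le_mult_iff)
  then have "sqrt ((ip f g)\<^sup>2) \<le> sqrt (ip f f * ip g g)" by (rule real_sqrt_le_mono)
  then show ?thesis by (simp add: norm_fun_def real_sqrt_mult)
qed

lemma norm_plus_le:
  assumes f: "f \<in> H" and g: "g \<in> H"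
  shows "norm_fun (plus_fun f g) \<le> norm_fun f + norm_fun g"
proof (rule power2_le_imp_le)
  have "(norm_fun (plus_fun f g))\<^sup>2 = ip f f + 2 * ip f g + ip g g"
    using f g by (simp add: norm_fun_power2 ip_commute[OF g f])
  also have "\<dots> \<le> ip f f + 2 * (norm_fun f * norm_fun g) + ip g g"
    using cauchy_schwarz[OF f g] by linarith
  also have "\<dots> = (norm_fun f + norm_fun g)\<^sup>2"
    using f g by (simp add: power2_sum norm_fun_power2)
  finally show "(norm_fun (plus_fun f g))\<^sup>2 \<le> (norm_fun f + norm_fun g)\<^sup>2" .
qed (use f g norm_fun_nonneg in auto)

lemma ip_dist_eq: "f \<in> H \<Longrightarrow> g \<in> H \<Longrightarrow> ip_dist X H ip f g = norm_fun (diff_fun f g)"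
  by (simp add: ip_dist_def norm_fun_def diff_fun_def)

lemma ip_dist_power2: "f \<in> H \<Longrightarrow> g \<in> H \<Longrightarrow> (ip_dist X H ip f g)\<^sup>2 = ip f f - 2 * ip f g + ip g g"
  by (simp add: ip_dist_eq norm_fun_power2 ip_commute[of g f])

sublocale Metric_space H "ip_dist X H ip"
proof
  fix f g h
  show "0 \<le> ip_dist X H ip f g"
    using norm_fun_nonneg[OF diff_in] by (cases "f \<in> H \<and> g \<in> H") (auto simp: ip_dist_eq, auto simp: ip_dist_def)
  show "ip_dist X H ip f g = ip_dist X H ip g f"
  proof (cases "f \<in> H \<and> g \<in> H")
    case True
    then have "(ip_dist X H ip f g)\<^sup>2 = (ip_dist X H ip g f)\<^sup>2"
      by (simp add: ip_dist_power2 ip_commute[of g f])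
    then show ?thesis
      using True norm_fun_nonneg[OF diff_in] by (simp add: ip_dist_eq)
  qed (auto simp: ip_dist_def)
  assume f: "f \<in> H" and g: "g \<in> H"
  show "ip_dist X H ip f g = 0 \<longleftrightarrow> f = g"
  proof
    assume "ip_dist X H ip f g = 0"
    then have "ip (diff_fun f g) (diff_fun f g) = 0" using f g by (simp add: ip_dist_eq norm_fun_def)
    then have 0: "diff_fun f g = (\<lambda>x\<in>X. 0)" using f g by (intro ip_zeroD) auto
    have "f x = g x" if "x \<in> X" for x
      using fun_cong[OF 0, of x] that by (simp add: diff_fun_def)
    then show "f = g" using in_extensional f g by (intro extensionalityI)
  next
    assume "f = g"
    then show "ip_dist X H ip f g = 0" using f by (simp add: ip_dist_eq norm_fun_def)
  qed
  assume h: "h \<in> H"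
  have "diff_fun f h = plus_fun (diff_fun f g) (diff_fun g h)"
    by (auto simp: diff_fun_def plus_fun_def)
  then show "ip_dist X H ip f h \<le> ip_dist X H ip f g + ip_dist X H ip g h"
    using norm_plus_le[of "diff_fun f g" "diff_fun g h"] f g h by (simp add: ip_dist_eq)
qed

lemma ip_dist_zero_fun:
  assumes f: "f \<in> H"
  shows "ip_dist X H ip f (\<lambda>x\<in>X. 0) = norm_fun f"
proof -
  have "diff_fun f (\<lambda>x\<in>X. 0) = f"
    using in_extensional[OF f] by (auto simp: diff_fun_def extensional_def)
  then show ?thesis using f zero_in by (simp add: ip_dist_eq)
qed

lemma norm_fun_diff_le:
  assumes f: "f \<in> H" and g: "g \<in> H"
  shows "\<bar>norm_fun f - norm_fun g\<bar> \<le> ip_dist X H ip f g"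
  using mdist_reverse_triangle[OF f zero_in g] ip_dist_zero_fun[OF f] ip_dist_zero_fun[OF g]
    commute[of _ g]
  by simp

section \<open>Midpoints and minimization of regularized functionals\<close>

definition mid_fun where "mid_fun f g = scale_fun (1 / 2) (plus_fun f g)"

lemma mid_in [simp]: "f \<in> H \<Longrightarrow> g \<in> H \<Longrightarrow> mid_fun f g \<in> H"
  by (simp add: mid_fun_def)

text \<open>The parallelogram law. The subtracted term is the source of strong convexity, both for
  the existence of minimizers and for their stability.\<close>

lemma ip_mid_fun:
  "f \<in> H \<Longrightarrow> g \<in> H \<Longrightarrow>
    ip (mid_fun f g) (mid_fun f g) = (ip f f + ip g g) / 2 - (ip_dist X H ip f g)\<^sup>2 / 4"
  by (simp add: mid_fun_def ip_dist_power2 ip_commute[of g f] field_simps)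

text \<open>The gain at midpoints forces minimizing sequences to be Cauchy, so completeness of
  \<open>H\<close> replaces weak compactness. The Lipschitz bound gives boundedness from below and
  continuity at the limit.\<close>

lemma regularized_minimizer_exists:
  fixes \<Phi> :: "('x \<Rightarrow> real) \<Rightarrow> real"
  assumes c: "0 < c"
    and convex: "\<And>f g. f \<in> H \<Longrightarrow> g \<in> H \<Longrightarrow> \<Phi> (mid_fun f g) \<le> (\<Phi> f + \<Phi> g) / 2"
    and lip: "\<And>f g. f \<in> H \<Longrightarrow> g \<in> H \<Longrightarrow> \<bar>\<Phi> f - \<Phi> g\<bar> \<le> K * ip_dist X H ip f g"
  shows "\<exists>f\<in>H. \<forall>g\<in>H. \<Phi> f + c * ip f f \<le> \<Phi> g + c * ip g g"
proof -
  define \<Psi> where "\<Psi> f = \<Phi> f + c * ip f f" for f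
  let ?d = "ip_dist X H ip"
  have mid: "\<Psi> (mid_fun f g) \<le> (\<Psi> f + \<Psi> g) / 2 - c / 4 * (?d f g)\<^sup>2" if "f \<in> H" "g \<in> H" for f g
    using convex[OF that] unfolding \<Psi>_def by (simp add: ip_mid_fun that field_simps)
  \<comment> \<open>Completing the square: \<open>- K * r + c * r\<^sup>2\<close> has minimum
    \<open>- K\<^sup>2 / (4 * c)\<close>, attained at \<open>r = K / (2 * c)\<close>.\<close>
  have lower: "\<Phi> (\<lambda>x\<in>X. 0) - K\<^sup>2 / (4 * c) \<le> \<Psi> f" if f: "f \<in> H" for f
  proof -
    have "\<bar>\<Phi> f - \<Phi> (\<lambda>x\<in>X. 0)\<bar> \<le> K * norm_fun f"
      using lip[OF f zero_in] by (simp add: ip_dist_zero_fun[OF f])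
    then have "\<Phi> (\<lambda>x\<in>X. 0) - K * norm_fun f + c * (norm_fun f)\<^sup>2 \<le> \<Psi> f"
      by (simp add: \<Psi>_def norm_fun_power2[OF f])
    moreover have "0 \<le> c * (norm_fun f - K / (2 * c))\<^sup>2" using c by simp
    moreover have "c * (norm_fun f - K / (2 * c))\<^sup>2 = c * (norm_fun f)\<^sup>2 - K * norm_fun f + K\<^sup>2 / (4 * c)"
      using c by (simp add: power2_diff power_divide field_simps power2_eq_square)
    ultimately show ?thesis by linarith
  qed
  define m where "m = (INF f\<in>H. \<Psi> f)"
  have bdd: "bdd_below (\<Psi> ` H)" using lower by (rule bdd_belowI2)
  have m_le: "m \<le> \<Psi> f" if "f \<in> H" for f
    unfolding m_def by (rule cINF_lower[OF bdd that])
  have "\<exists>f\<in>H. \<Psi> f < m + 1 / (real n + 1)" for n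
  proof -
    have "(INF f\<in>H. \<Psi> f) < m + 1 / (real n + 1)" unfolding m_def by simp
    then show ?thesis using cINF_less_iff[OF _ bdd] zero_in by blast
  qed
  then obtain s where s: "\<And>n. s n \<in> H" "\<And>n::nat. \<Psi> (s n) < m + 1 / (real n + 1)" by metis
  \<comment> \<open>The midpoint value is at least \<open>m\<close> and at most the average of two
    values below \<open>m + 1 / (N + 1)\<close>, minus the convexity gain; hence the gain is at most
    \<open>1 / (N + 1)\<close>.\<close>
  have close: "c / 4 * (?d (s n) (s l))\<^sup>2 \<le> 1 / (real N + 1)" if "N \<le> n" "N \<le> l" for N n l
  proof -
    have "1 / (real n + 1) \<le> 1 / (real N + 1)" "1 / (real l + 1) \<le> 1 / (real N + 1)"
      using that by (auto intro!: divide_left_mono)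
    then show ?thesis
      using mid[OF s(1) s(1), of n l] m_le[OF mid_in[OF s(1) s(1)], of n l] s(2)[of n] s(2)[of l]
      by argo
  qed
  have "MCauchy s"
    unfolding MCauchy_def
  proof (intro conjI allI impI)
    show "range s \<subseteq> H" using s by auto
    fix e :: real assume e: "e > 0"
    \<comment> \<open>\<open>close\<close> bounds the squared distance by
      \<open>4 / (c * (N + 1))\<close>, which this \<open>N\<close> makes smaller than
      \<open>e\<^sup>2\<close>.\<close>
    obtain N :: nat where N: "4 / (c * e\<^sup>2) < real N" using reals_Archimedean2 by blast
    have "?d (s n) (s l) < e" if "N \<le> n" "N \<le> l" for n l
    proof (rule power_less_imp_less_base[of _ 2])
      have "c * e\<^sup>2 > 0" using c e by simp
      then have "4 < c * e\<^sup>2 * (real N + 1)" using N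
        by (simp add: divide_less_eq algebra_simps add_strict_increasing)
      moreover have "c * (?d (s n) (s l))\<^sup>2 * (real N + 1) \<le> 4"
        using close[OF that] by (simp add: field_simps)
      ultimately have "c * (?d (s n) (s l))\<^sup>2 * (real N + 1) < c * e\<^sup>2 * (real N + 1)" by linarith
      then show "(?d (s n) (s l))\<^sup>2 < e\<^sup>2" using c by simp
    qed (use e in simp)
    then show "\<exists>N. \<forall>n n'. N \<le> n \<longrightarrow> N \<le> n' \<longrightarrow> ?d (s n) (s n') < e" by blast
  qed
  then obtain f where lim: "limitin mtopology s f sequentially"
    using complete unfolding mcomplete_def by blast
  then have f: "f \<in> H" and dlim: "(\<lambda>n. ?d (s n) f) \<longlonglongrightarrow> 0"
    using limitin_metric_dist_null by auto
  have "(\<lambda>n. norm_fun (s n) - norm_fun f) \<longlonglongrightarrow> 0"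
    by (rule tendsto_0_le[OF dlim, of _ 1]) (use norm_fun_diff_le[OF s(1) f] in auto)
  then have "(\<lambda>n. norm_fun (s n)) \<longlonglongrightarrow> norm_fun f" by (simp add: LIM_zero_iff)
  then have nlim: "(\<lambda>n. ip (s n) (s n)) \<longlonglongrightarrow> ip f f"
    using tendsto_power[of "\<lambda>n. norm_fun (s n)" "norm_fun f" sequentially 2] by (simp add: norm_fun_power2 s f)
  have "(\<lambda>n. \<Phi> (s n) - \<Phi> f) \<longlonglongrightarrow> 0"
  proof (rule tendsto_0_le[OF dlim, of _ "\<bar>K\<bar>"])
    have "\<bar>\<Phi> (s n) - \<Phi> f\<bar> \<le> ?d (s n) f * \<bar>K\<bar>" for n
      using lip[OF s(1) f, of n] mult_right_mono[OF abs_ge_self[of K] nonneg[of "s n" f]]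
      by (simp add: mult.commute)
    then show "\<forall>\<^sub>F n in sequentially. norm (\<Phi> (s n) - \<Phi> f) \<le> norm (?d (s n) f) * \<bar>K\<bar>"
      by simp
  qed
  then have "(\<lambda>n. \<Phi> (s n)) \<longlonglongrightarrow> \<Phi> f" by (simp add: LIM_zero_iff)
  then have "(\<lambda>n. \<Psi> (s n)) \<longlonglongrightarrow> \<Psi> f"
    unfolding \<Psi>_def by (intro tendsto_intros nlim)
  moreover have "(\<lambda>n. m + 1 / (real n + 1)) \<longlonglongrightarrow> m + 0"
    by (intro tendsto_intros LIMSEQ_inverse_real_of_nat[unfolded inverse_eq_divide, simplified])
       (use LIMSEQ_inverse_real_of_nat in \<open>simp add: inverse_eq_divide add.commute\<close>)
  ultimately have "\<Psi> f \<le> m + 0"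
    by (rule LIMSEQ_le) (use s(2) in \<open>auto intro: less_imp_le\<close>)
  then show ?thesis
    using f m_le unfolding \<Psi>_def by (intro bexI[of _ f] ballI) (simp_all add: order_trans)
qed

end

section \<open>The SVM operator\<close>

locale svm_setting = Z: Metric_space "X \<times> Y" dZ + function_hilbert_space X H ip
  for X :: "'x::topological_space set" and Y :: "real set" and dZ H ip +
  fixes L :: "'x \<Rightarrow> real \<Rightarrow> real \<Rightarrow> real" and lip :: real and k :: "'x \<Rightarrow> 'x \<Rightarrow> real" and reg :: real
  assumes Z_topology: "Z.mtopology = top_of_set (X \<times> Y)"
    and Z_compact: "compact (X \<times> Y)"
    and L_continuous: "continuous_on (X \<times> Y \<times> UNIV) (\<lambda>(x, y, t). L x y t)"
    and L_convex: "\<And>x y. x \<in> X \<Longrightarrow> y \<in> Y \<Longrightarrow> convex_on UNIV (L x y)"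
    and L_lipschitz: "\<And>x y. x \<in> X \<Longrightarrow> y \<in> Y \<Longrightarrow> lip-lipschitz_on UNIV (L x y)"
    and lip_pos: "0 < lip"
    and k_continuous: "continuous_on (X \<times> X) (\<lambda>(x, x'). k x x')"
    and k_in: "\<And>x. x \<in> X \<Longrightarrow> (\<lambda>u\<in>X. k u x) \<in> H"
    and reproducing: "\<And>x f. x \<in> X \<Longrightarrow> f \<in> H \<Longrightarrow> f x = ip f (\<lambda>u\<in>X. k u x)"
    and k_bounded: "bdd_above ((\<lambda>x. k x x) ` X)"
    and reg_pos: "0 < reg"
begin

section \<open>The canonical feature map and bounds for point evaluation\<close>

definition feature where "feature x = (\<lambda>u\<in>X. k u x)"
text \<open>The supremum is unspecified if \<open>X\<close> is empty, hence the absolute value.\<close>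
definition \<kappa> where "\<kappa> = sqrt \<bar>SUP x\<in>X. k x x\<bar>"

lemma feature_in [simp]: "x \<in> X \<Longrightarrow> feature x \<in> H"
  by (simp add: feature_def k_in)

lemma eval_eq: "x \<in> X \<Longrightarrow> f \<in> H \<Longrightarrow> f x = ip f (feature x)"
  by (simp add: feature_def reproducing)

lemma ip_feature: "x \<in> X \<Longrightarrow> x' \<in> X \<Longrightarrow> ip (feature x) (feature x') = k x x'"
  using ip_commute[of "feature x" "feature x'"] eval_eq[of x "feature x'"]
  by (simp add: feature_def k_in)

lemma kappa_nonneg: "0 \<le> \<kappa>"
  by (simp add: \<kappa>_def)

lemma norm_feature_le: "x \<in> X \<Longrightarrow> norm_fun (feature x) \<le> \<kappa>"
  unfolding norm_fun_def \<kappa>_def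
  using cSUP_upper[OF _ k_bounded, of x] by (auto simp: ip_feature)

lemma eval_diff_le:
  assumes "x \<in> X" "f \<in> H" "g \<in> H"
  shows "\<bar>f x - g x\<bar> \<le> \<kappa> * ip_dist X H ip f g"
proof -
  have "f x - g x = ip (diff_fun f g) (feature x)"
    using assms by (simp add: eval_eq)
  also have "\<bar>\<dots>\<bar> \<le> norm_fun (diff_fun f g) * norm_fun (feature x)"
    using assms by (intro cauchy_schwarz) auto
  also have "\<dots> \<le> norm_fun (diff_fun f g) * \<kappa>"
    using assms by (intro mult_left_mono norm_feature_le norm_fun_nonneg) auto
  finally show ?thesis using assms by (simp add: ip_dist_eq mult.commute)
qed

lemma abs_eval_le:
  assumes "x \<in> X" "f \<in> H"
  shows "\<bar>f x\<bar> \<le> \<kappa> * norm_fun f"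
proof -
  have "\<bar>f x\<bar> \<le> norm_fun f * norm_fun (feature x)"
    using assms cauchy_schwarz[of f "feature x"] by (simp add: eval_eq)
  also have "\<dots> \<le> norm_fun f * \<kappa>"
    using assms by (intro mult_left_mono norm_feature_le norm_fun_nonneg) auto
  finally show ?thesis by (simp add: mult.commute)
qed

text \<open>Gives a norm ball of \<open>H\<close> one common modulus of continuity, measured by the
  distance of the features.\<close>

lemma eval_eval_diff_le:
  assumes "x \<in> X" "x' \<in> X" "f \<in> H"
  shows "\<bar>f x - f x'\<bar> \<le> norm_fun f * ip_dist X H ip (feature x) (feature x')"
  using assms cauchy_schwarz[of f "diff_fun (feature x) (feature x')"]
  by (simp add: eval_eq ip_dist_eq)

lemma L_lipD: "x \<in> X \<Longrightarrow> y \<in> Y \<Longrightarrow> \<bar>L x y s - L x y t\<bar> \<le> lip * \<bar>s - t\<bar>"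
  using lipschitz_onD[OF L_lipschitz, of x y s t] by (simp add: dist_real_def)

section \<open>The shifted loss along functions of \<open>H\<close>\<close>

definition loss_fun where "loss_fun f = (\<lambda>(x, y). shifted_loss L x y (f x))"

lemma shifted_risk_eq: "shifted_risk L P f = integral\<^sup>L P (loss_fun f)"
  by (simp add: shifted_risk_def loss_fun_def)

lemma loss_fun_diff_le:
  assumes "z \<in> X \<times> Y" "f \<in> H" "g \<in> H"
  shows "\<bar>loss_fun f z - loss_fun g z\<bar> \<le> lip * \<kappa> * ip_dist X H ip f g"
proof -
  obtain x y where z: "z = (x, y)" "x \<in> X" "y \<in> Y" using assms(1) by auto
  have "\<bar>loss_fun f z - loss_fun g z\<bar> \<le> lip * \<bar>f x - g x\<bar>"
    using L_lipD[OF z(2,3)] by (simp add: z loss_fun_def shifted_loss_def)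
  also have "\<dots> \<le> lip * (\<kappa> * ip_dist X H ip f g)"
    using eval_diff_le[OF z(2) assms(2,3)] lip_pos by (intro mult_left_mono) auto
  finally show ?thesis by simp
qed

lemma abs_loss_fun_le:
  assumes "z \<in> X \<times> Y" "f \<in> H"
  shows "\<bar>loss_fun f z\<bar> \<le> lip * \<kappa> * norm_fun f"
proof -
  obtain x y where z: "z = (x, y)" "x \<in> X" "y \<in> Y" using assms(1) by auto
  have "\<bar>loss_fun f z\<bar> \<le> lip * \<bar>f x\<bar>"
    using L_lipD[OF z(2,3), of "f x" 0] by (simp add: z loss_fun_def shifted_loss_def)
  also have "\<dots> \<le> lip * (\<kappa> * norm_fun f)"
    using abs_eval_le[OF z(2) assms(2)] lip_pos by (intro mult_left_mono) auto
  finally show ?thesis by simp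
qed

lemma compact_space_Z: "compact_space Z.mtopology"
  using Z_compact by (simp add: Z_topology compact_space_subtopology)

lemma finite_grid:
  assumes "0 < (r :: real)"
  obtains S where "finite S" "\<And>t. \<bar>t\<bar> \<le> B \<Longrightarrow> \<exists>s\<in>S. \<bar>t - s\<bar> < r"
proof -
  obtain S where S: "finite S" "{-B..B} \<subseteq> (\<Union>s\<in>S. ball s r)"
    using seq_compact_imp_totally_bounded[of "{-B..B}"] assms compact_Icc
    by (meson compact_imp_seq_compact)
  moreover have "\<exists>s\<in>S. \<bar>t - s\<bar> < r" if "\<bar>t\<bar> \<le> B" for t
  proof -
    have "t \<in> {-B..B}" using that by auto
    then have "t \<in> (\<Union>s\<in>S. ball s r)" using S(2) by blast
    then show ?thesis by (auto simp: dist_real_def abs_minus_commute)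
  qed
  ultimately show ?thesis using that by blast
qed

text \<open>The distances of the features and of finitely many sections of the loss form one continuous
  pseudometric on the compact space, so a single Lebesgue number controls all of them; Lipschitz
  continuity in the third argument takes care of the remaining sections.\<close>

lemma loss_fun_equicontinuous:
  assumes R: "0 \<le> R" and e: "0 < e"
  shows "\<exists>\<delta>>0. \<forall>h\<in>loss_fun ` {f \<in> H. norm_fun f \<le> R}. \<forall>z\<in>X \<times> Y. \<forall>z'\<in>X \<times> Y.
    dZ z z' < \<delta> \<longrightarrow> \<bar>h z - h z'\<bar> < e"
proof -
  \<comment> \<open>Replacing \<open>f x\<close> by a grid point then changes each of two loss
    values by at most \<open>e / 8\<close>.\<close>
  have "e / (8 * lip) > 0" using e lip_pos by simp
  then obtain S where S: "finite S" "\<And>t. \<bar>t\<bar> \<le> \<kappa> * R \<Longrightarrow> \<exists>s\<in>S. \<bar>t - s\<bar> < e / (8 * lip)"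
    using finite_grid by metis
  define E1 where "E1 z z' = ip_dist X H ip (feature (fst z)) (feature (fst z'))" for z z' :: "'x \<times> real"
  define E2 where "E2 s z z' = \<bar>L (fst z) (snd z) s - L (fst z') (snd z') s\<bar>" for s z z'
  \<comment> \<open>The section at 0 is added to the grid because the shifted loss subtracts
    \<open>L x y 0\<close>.\<close>
  define E where "E z z' = E1 z z' + (\<Sum>s\<in>insert 0 S. E2 s z z')" for z z'
  \<comment> \<open>Expressed through \<open>k\<close>, the feature distance inherits the continuity
    of the kernel.\<close>
  have E1_eq: "E1 z z' = sqrt (k (fst z) (fst z) - 2 * k (fst z) (fst z') + k (fst z') (fst z'))"
    if "z \<in> X \<times> Y" "z' \<in> X \<times> Y" for z z'
  proof -
    have "(E1 z z')\<^sup>2 = k (fst z) (fst z) - 2 * k (fst z) (fst z') + k (fst z') (fst z')"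
      using that by (auto simp: E1_def ip_dist_power2 ip_feature)
    then show ?thesis by (metis E1_def nonneg real_sqrt_abs abs_of_nonneg)
  qed
  have cont: "continuous_on (X \<times> Y) (E z)" if z: "z \<in> X \<times> Y" for z
  proof -
    have "continuous_on (X \<times> Y) (\<lambda>z'. (\<lambda>(x, x'). k x x') (fst z, fst z'))"
      by (rule continuous_on_compose2[OF k_continuous]) (use z in \<open>auto intro!: continuous_intros\<close>)
    then have k1: "continuous_on (X \<times> Y) (\<lambda>z'. k (fst z) (fst z'))" by simp
    have "continuous_on (X \<times> Y) (\<lambda>z'. (\<lambda>(x, x'). k x x') (fst z', fst z'))"
      by (rule continuous_on_compose2[OF k_continuous]) (auto intro!: continuous_intros)
    then have k2: "continuous_on (X \<times> Y) (\<lambda>z'. k (fst z') (fst z'))" by simp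
    have "continuous_on (X \<times> Y) (\<lambda>z'. (\<lambda>(x, y, t). L x y t) (fst z', snd z', s))" for s
      by (rule continuous_on_compose2[OF L_continuous]) (auto intro!: continuous_intros)
    then have l1: "continuous_on (X \<times> Y) (\<lambda>z'. L (fst z') (snd z') s)" for s by simp
    have "continuous_on (X \<times> Y) (\<lambda>z'. sqrt (k (fst z) (fst z) - 2 * k (fst z) (fst z') + k (fst z') (fst z'))
        + (\<Sum>s\<in>insert 0 S. E2 s z z'))"
      unfolding E2_def by (intro continuous_intros k1 k2 l1)
    then show ?thesis
      by (rule continuous_on_eq) (simp add: E_def E1_eq[OF z])
  qed
  have E_zero: "E z z = 0" if "z \<in> X \<times> Y" for z
    using that by (auto simp: E_def E1_def E2_def)
  \<comment> \<open>\<open>E\<close> enters the final estimate with factor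
    \<open>2 + lip * R\<close>: once for the section at \<open>s\<close>, once for the section at 0,
    and \<open>lip * R\<close> times for the change from \<open>f x\<close> to \<open>f x'\<close>.
    Together this stays below \<open>e / 2\<close>, and the two grid errors add
    \<open>e / 4\<close>.\<close>
  have "e / (2 * (2 + lip * R)) > 0" (is "?e > 0")
    using e lip_pos R by (intro divide_pos_pos) (auto intro: add_pos_nonneg)
  then have "\<exists>\<delta>>0. \<forall>z\<in>X \<times> Y. \<forall>z'\<in>X \<times> Y. dZ z z' < \<delta> \<longrightarrow> E z z' < ?e"
  proof (rule Z.compact_uniformly_small[OF compact_space_Z, rotated 3])
    fix z z' assume z: "z \<in> X \<times> Y" "z' \<in> X \<times> Y"
    show "E z z' = E z' z"
      by (simp add: E_def E1_def E2_def commute[of "feature (fst z)"] abs_minus_commute)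
    fix w assume w: "w \<in> X \<times> Y"
    have "E1 z w \<le> E1 z z' + E1 z' w"
      unfolding E1_def by (rule triangle) (use z w in auto)
    moreover have "(\<Sum>s\<in>insert 0 S. E2 s z w) \<le> (\<Sum>s\<in>insert 0 S. E2 s z z' + E2 s z' w)"
      by (intro sum_mono) (auto simp: E2_def)
    ultimately show "E z w \<le> E z z' + E z' w"
      by (simp add: E_def sum.distrib)
  next
    fix z r assume z: "z \<in> X \<times> Y" and r: "0 < (r::real)"
    have "openin (top_of_set (X \<times> Y)) ((X \<times> Y) \<inter> E z -` {..<r})"
      using continuous_openin_preimage_gen[OF cont[OF z] open_lessThan] .
    then show "\<exists>U. openin Z.mtopology U \<and> z \<in> U \<and> (\<forall>y\<in>U. E z y < r)"
      using z r E_zero[OF z] by (intro exI[of _ "(X \<times> Y) \<inter> E z -` {..<r}"]) (auto simp: Z_topology)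
  qed
  then obtain \<delta> where \<delta>: "\<delta> > 0"
    "\<And>z z'. z \<in> X \<times> Y \<Longrightarrow> z' \<in> X \<times> Y \<Longrightarrow> dZ z z' < \<delta> \<Longrightarrow> E z z' < ?e"
    by blast
  have "\<bar>loss_fun f z - loss_fun f z'\<bar> < e"
    if f: "f \<in> H" "norm_fun f \<le> R" and z: "z \<in> X \<times> Y" "z' \<in> X \<times> Y" and zz: "dZ z z' < \<delta>" for f z z'
  proof -
    obtain x y x' y' where xy: "z = (x, y)" "z' = (x', y')" "x \<in> X" "y \<in> Y" "x' \<in> X" "y' \<in> Y"
      using z by auto
    have E2_nn: "0 \<le> E2 s z z'" for s by (simp add: E2_def)
    have E1_nn: "0 \<le> E1 z z'" by (simp add: E1_def)
    have E1_le: "E1 z z' \<le> E z z'"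
      unfolding E_def by (simp only: le_add_same_cancel1) (intro sum_nonneg E2_nn)
    have E2_le: "E2 s z z' \<le> E z z'" if "s \<in> insert 0 S" for s
    proof -
      have "E2 s z z' \<le> (\<Sum>s\<in>insert 0 S. E2 s z z')"
        using S(1) that by (intro member_le_sum E2_nn) auto
      then show ?thesis unfolding E_def using E1_nn by linarith
    qed
    have "\<bar>f x\<bar> \<le> \<kappa> * R"
      using abs_eval_le[OF xy(3) f(1)] mult_left_mono[OF f(2) kappa_nonneg] by linarith
    then obtain s where s: "s \<in> S" "\<bar>f x - s\<bar> < e / (8 * lip)" using S(2) by blast
    have "lip * \<bar>f x - s\<bar> \<le> lip * (e / (8 * lip))" using s lip_pos by (intro mult_left_mono) auto
    then have sl: "lip * \<bar>f x - s\<bar> \<le> e / 8" using lip_pos by simp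
    \<comment> \<open>The chain runs from \<open>L x y (f x)\<close> to \<open>L x y s\<close>, on
      to \<open>L x' y' s\<close>, back to \<open>L x' y' (f x)\<close> and finally to
      \<open>L x' y' (f x')\<close>; the values at 0 are compared separately.\<close>
    have 1: "\<bar>L x y (f x) - L x y s\<bar> \<le> e / 8" using L_lipD[OF xy(3,4), of "f x" s] sl by linarith
    have 2: "\<bar>L x' y' (f x) - L x' y' s\<bar> \<le> e / 8" using L_lipD[OF xy(5,6), of "f x" s] sl by linarith
    have 3: "\<bar>L x y s - L x' y' s\<bar> \<le> E z z'" "\<bar>L x y 0 - L x' y' 0\<bar> \<le> E z z'"
      using E2_le[of s] E2_le[of 0] s by (auto simp: E2_def xy)
    have "\<bar>f x - f x'\<bar> \<le> norm_fun f * E1 z z'"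
      using eval_eval_diff_le[OF xy(3,5) f(1)] by (simp add: E1_def xy)
    also have "\<dots> \<le> R * E z z'"
      using f E1_le E1_nn norm_fun_nonneg[OF f(1)] R by (intro mult_mono) auto
    finally have "lip * \<bar>f x - f x'\<bar> \<le> lip * (R * E z z')"
      using lip_pos by (intro mult_left_mono) auto
    then have 4: "\<bar>L x' y' (f x) - L x' y' (f x')\<bar> \<le> lip * R * E z z'"
      using L_lipD[OF xy(5,6), of "f x" "f x'"] by (simp add: mult.assoc)
    have pos: "2 + lip * R > 0" using lip_pos R by (intro add_pos_nonneg) auto
    have "(2 + lip * R) * E z z' < (2 + lip * R) * ?e"
      using \<delta>(2)[OF z zz] pos by (rule mult_strict_left_mono)
    also have "\<dots> = e / 2" using nonzero_mult_divide_mult_cancel_right[of "2 + lip * R" e 2] pos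
      by (simp only: times_divide_eq_right mult.commute[of "2 + lip * R"])
    finally have "2 * E z z' + lip * R * E z z' < e / 2" by (simp add: distrib_right)
    then show ?thesis
      using 1 2 3 4 e unfolding loss_fun_def shifted_loss_def xy prod.case by linarith
  qed
  then show ?thesis using \<delta>(1) by blast
qed

text \<open>The ball of radius \<open>norm_fun f\<close> contains \<open>f\<close>, so
  equicontinuity gives continuity, hence measurability, of its loss.\<close>

lemma integrable_loss_fun:
  assumes P: "P \<in> borel_probs (X \<times> Y) dZ" and f: "f \<in> H"
  shows "integrable P (loss_fun f)"
proof (rule Z.integrable_borel_probs[OF P])
  show "loss_fun f \<in> borel_measurable (metric_borel (X \<times> Y) dZ)"
  proof (rule Z.borel_measurable_metric_borelI)
    fix z e :: _ assume z: "z \<in> X \<times> Y" "(0::real) < e"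
    show "\<exists>\<delta>>0. \<forall>z'\<in>X \<times> Y. dZ z z' < \<delta> \<longrightarrow> \<bar>loss_fun f z - loss_fun f z'\<bar> < e"
      using loss_fun_equicontinuous[OF norm_fun_nonneg[OF f] z(2)] f z(1) by blast
  qed
qed (use abs_loss_fun_le f in blast)

lemma shifted_risk_lipschitz:
  assumes P: "P \<in> borel_probs (X \<times> Y) dZ" and "f \<in> H" "g \<in> H"
  shows "\<bar>shifted_risk L P f - shifted_risk L P g\<bar> \<le> lip * \<kappa> * ip_dist X H ip f g"
proof -
  interpret P: prob_space P using Z.borel_probsD P by blast
  have int: "integrable P (loss_fun f)" "integrable P (loss_fun g)"
    using integrable_loss_fun assms by auto
  have "\<bar>shifted_risk L P f - shifted_risk L P g\<bar> = \<bar>\<integral>z. loss_fun f z - loss_fun g z \<partial>P\<bar>"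
    using int by (simp add: shifted_risk_eq)
  also have "\<dots> \<le> (\<integral>z. \<bar>loss_fun f z - loss_fun g z\<bar> \<partial>P)"
    by (rule integral_abs_bound)
  also have "\<dots> \<le> lip * \<kappa> * ip_dist X H ip f g"
    by (rule P.integral_le_const)
       (use int loss_fun_diff_le assms Z.borel_probsD[OF P] in auto)
  finally show ?thesis .
qed

lemma shifted_risk_mid_le:
  assumes P: "P \<in> borel_probs (X \<times> Y) dZ" and f: "f \<in> H" and g: "g \<in> H"
  shows "shifted_risk L P (mid_fun f g) \<le> (shifted_risk L P f + shifted_risk L P g) / 2"
proof -
  have int: "integrable P (loss_fun f)" "integrable P (loss_fun g)" "integrable P (loss_fun (mid_fun f g))"
    using integrable_loss_fun[OF P] f g by auto
  have "loss_fun (mid_fun f g) z \<le> (loss_fun f z + loss_fun g z) / 2" if z: "z \<in> X \<times> Y" for z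
  proof -
    obtain x y where xy: "z = (x, y)" "x \<in> X" "y \<in> Y" using z by auto
    have "L x y ((1 - 1 / 2) *\<^sub>R f x + (1 / 2) *\<^sub>R g x) \<le> (1 - 1 / 2) * L x y (f x) + 1 / 2 * L x y (g x)"
      using L_convex[OF xy(2,3)] by (rule convex_onD) auto
    also have "(1 - 1 / 2) *\<^sub>R f x + (1 / 2) *\<^sub>R g x = mid_fun f g x"
      using xy by (simp add: mid_fun_def scale_fun_def plus_fun_def)
    finally show ?thesis
      by (simp add: xy loss_fun_def shifted_loss_def)
  qed
  then have "integral\<^sup>L P (loss_fun (mid_fun f g)) \<le> (\<integral>z. (loss_fun f z + loss_fun g z) / 2 \<partial>P)"
    using int Z.borel_probsD[OF P] by (intro integral_mono) auto
  then show ?thesis using int by (simp add: shifted_risk_eq)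
qed

text \<open>\<open>arg_min_on\<close> is a choice operator; it acquires the minimizing property from
  the existence of some minimizer.\<close>

lemma svm_minimizes:
  assumes P: "P \<in> borel_probs (X \<times> Y) dZ"
  shows "svm L H ip reg P \<in> H"
    "g \<in> H \<Longrightarrow> shifted_risk L P (svm L H ip reg P) + reg * ip (svm L H ip reg P) (svm L H ip reg P)
      \<le> shifted_risk L P g + reg * ip g g"
proof -
  let ?\<Psi> = "\<lambda>f. shifted_risk L P f + reg * ip f f"
  obtain f where "f \<in> H" "\<And>g. g \<in> H \<Longrightarrow> ?\<Psi> f \<le> ?\<Psi> g"
    using regularized_minimizer_exists[OF reg_pos shifted_risk_mid_le[OF P] shifted_risk_lipschitz[OF P]]
    by blast
  then have "is_arg_min ?\<Psi> (\<lambda>f. f \<in> H) f"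
    by (auto simp: is_arg_min_linorder)
  then have "is_arg_min ?\<Psi> (\<lambda>f. f \<in> H) (svm L H ip reg P)"
    unfolding svm_def arg_min_on_def arg_min_def
    by (rule someI[where P = "is_arg_min ?\<Psi> (\<lambda>f. f \<in> H)"])
  then show "svm L H ip reg P \<in> H"
    "g \<in> H \<Longrightarrow> ?\<Psi> (svm L H ip reg P) \<le> ?\<Psi> g"
    by (auto simp: is_arg_min_linorder)
qed

text \<open>Comparison with the zero function, whose shifted risk is 0: the penalty
  \<open>reg * ip f f\<close> is at most minus the risk, which is linear in the norm. The bound does
  not involve \<open>P\<close>, so all solutions lie in one ball, and this ball carries the
  equicontinuous family of losses.\<close>

lemma norm_svm_le:
  assumes P: "P \<in> borel_probs (X \<times> Y) dZ"
  shows "norm_fun (svm L H ip reg P) \<le> lip * \<kappa> / reg"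
proof -
  let ?f = "svm L H ip reg P"
  note f = svm_minimizes(1)[OF P]
  have "loss_fun (\<lambda>x\<in>X. 0) z = 0" if "z \<in> X \<times> Y" for z
    using that by (auto simp: loss_fun_def shifted_loss_def)
  then have "shifted_risk L P (\<lambda>x\<in>X. 0) = 0"
    unfolding shifted_risk_eq using Z.borel_probsD[OF P] by (intro integral_eq_zero_AE) auto
  then have "shifted_risk L P ?f + reg * ip ?f ?f \<le> 0"
    using svm_minimizes(2)[OF P zero_in] ip_zero_left[OF zero_in] by simp
  moreover have "\<bar>shifted_risk L P ?f\<bar> \<le> lip * \<kappa> * norm_fun ?f"
    unfolding shifted_risk_eq
  proof (rule Z.abs_integral_borel_probs_le[OF P])
    show "loss_fun ?f \<in> borel_measurable (metric_borel (X \<times> Y) dZ)"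
      using borel_measurable_integrable[OF integrable_loss_fun[OF P f]]
      using Z.borel_probsD(2)[OF P] by (simp cong: measurable_cong_sets)
  qed (use abs_loss_fun_le f in blast)
  ultimately have "norm_fun ?f * (reg * norm_fun ?f) \<le> norm_fun ?f * (lip * \<kappa>)"
    using norm_fun_power2[OF f] by (simp add: power2_eq_square algebra_simps)
  then have "reg * norm_fun ?f \<le> lip * \<kappa>"
  proof (cases "norm_fun ?f = 0")
    case False
    then have "norm_fun ?f > 0" using norm_fun_nonneg[OF f] by linarith
    then show "norm_fun ?f * (reg * norm_fun ?f) \<le> norm_fun ?f * (lip * \<kappa>) \<Longrightarrow> ?thesis" by simp
  qed (use lip_pos kappa_nonneg in simp)
  then show ?thesis using reg_pos by (simp add: le_divide_eq mult.commute)
qed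

text \<open>Sum of the quadratic growth of the two regularized risks at their minimizers.\<close>

lemma svm_dist_power2_le:
  assumes P: "P \<in> borel_probs (X \<times> Y) dZ" and Q: "Q \<in> borel_probs (X \<times> Y) dZ"
  defines "f \<equiv> svm L H ip reg P" and "g \<equiv> svm L H ip reg Q"
  shows "reg * (ip_dist X H ip f g)\<^sup>2 \<le>
    (shifted_risk L P g - shifted_risk L Q g) + (shifted_risk L Q f - shifted_risk L P f)"
proof -
  \<comment> \<open>The minimal value is at most the midpoint value; the convexity gain
    \<open>reg / 4\<close> doubles to \<open>reg / 2\<close> on clearing the average. When the two
    growth bounds are added, the penalty terms cancel.\<close>
  have grow: "reg / 2 * (ip_dist X H ip f' g')\<^sup>2 \<le>
      (shifted_risk L R g' + reg * ip g' g') - (shifted_risk L R f' + reg * ip f' f')"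
    if R: "R \<in> borel_probs (X \<times> Y) dZ" and f': "f' = svm L H ip reg R" and g': "g' \<in> H" for R f' g'
  proof -
    have f'H: "f' \<in> H" using svm_minimizes(1)[OF R] by (simp add: f')
    have "reg * ip (mid_fun f' g') (mid_fun f' g')
        = (reg * ip f' f' + reg * ip g' g') / 2 - reg / 4 * (ip_dist X H ip f' g')\<^sup>2"
      using f'H g' by (simp add: ip_mid_fun field_simps)
    then show ?thesis
      using svm_minimizes(2)[OF R mid_in[OF f'H g']] shifted_risk_mid_le[OF R f'H g']
      unfolding f'[symmetric] by argo
  qed
  have "ip_dist X H ip f g = ip_dist X H ip g f" by (rule commute)
  then show ?thesis
    using grow[OF P f_def[THEN meta_eq_to_obj_eq], of g] grow[OF Q g_def[THEN meta_eq_to_obj_eq], of f]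
      svm_minimizes(1)[OF P] svm_minimizes(1)[OF Q]
    unfolding f_def[symmetric] g_def[symmetric] by simp
qed

lemma shifted_risk_uniformly_continuous:
  assumes e: "0 < e" and R: "0 \<le> R"
  obtains \<delta> where "\<delta> > 0" "\<And>P Q f. P \<in> borel_probs (X \<times> Y) dZ \<Longrightarrow> Q \<in> borel_probs (X \<times> Y) dZ \<Longrightarrow>
    bl_dist (X \<times> Y) dZ P Q < \<delta> \<Longrightarrow> f \<in> H \<Longrightarrow> norm_fun f \<le> R \<Longrightarrow>
    \<bar>shifted_risk L P f - shifted_risk L Q f\<bar> < e"
proof -
  have "\<exists>\<delta>>0. \<forall>P\<in>borel_probs (X \<times> Y) dZ. \<forall>Q\<in>borel_probs (X \<times> Y) dZ. bl_dist (X \<times> Y) dZ P Q < \<delta> \<longrightarrow>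
    (\<forall>h\<in>loss_fun ` {f \<in> H. norm_fun f \<le> R}. \<bar>integral\<^sup>L P h - integral\<^sup>L Q h\<bar> < e)"
  proof (rule Z.equicontinuous_integral_diff[OF _ loss_fun_equicontinuous[OF R] e])
    fix h z assume h: "h \<in> loss_fun ` {f \<in> H. norm_fun f \<le> R}" and z: "z \<in> X \<times> Y"
    then obtain f where f: "h = loss_fun f" "f \<in> H" "norm_fun f \<le> R" by blast
    have "lip * \<kappa> * norm_fun f \<le> lip * \<kappa> * R"
      using f lip_pos kappa_nonneg by (intro mult_left_mono) auto
    then show "\<bar>h z\<bar> \<le> lip * \<kappa> * R"
      using abs_loss_fun_le[OF z f(2)] f(1) by simp
  qed
  then obtain \<delta> where \<delta>: "\<delta> > 0"
    "\<forall>P\<in>borel_probs (X \<times> Y) dZ. \<forall>Q\<in>borel_probs (X \<times> Y) dZ. bl_dist (X \<times> Y) dZ P Q < \<delta> \<longrightarrow>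
      (\<forall>h\<in>loss_fun ` {f \<in> H. norm_fun f \<le> R}. \<bar>integral\<^sup>L P h - integral\<^sup>L Q h\<bar> < e)"
    by (elim exE conjE)
  show ?thesis
    by (rule that[of \<delta>]) (use \<delta> in \<open>auto simp: shifted_risk_eq\<close>)
qed

lemma svm_uniformly_continuous:
  assumes e: "0 < e"
  shows "\<exists>\<delta>>0. \<forall>P\<in>borel_probs (X \<times> Y) dZ. \<forall>Q\<in>borel_probs (X \<times> Y) dZ. bl_dist (X \<times> Y) dZ P Q < \<delta> \<longrightarrow>
    ip_dist X H ip (svm L H ip reg P) (svm L H ip reg Q) < e"
proof -
  \<comment> \<open>Two risk differences below this tolerance make \<open>reg\<close> times the
    squared distance smaller than \<open>reg * e\<^sup>2\<close>.\<close>
  have "reg * e\<^sup>2 / 2 > 0" using reg_pos e by simp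
  moreover have "0 \<le> lip * \<kappa> / reg" using lip_pos reg_pos kappa_nonneg by simp
  ultimately obtain \<delta> where \<delta>: "\<delta> > 0"
    "\<And>P Q f. P \<in> borel_probs (X \<times> Y) dZ \<Longrightarrow> Q \<in> borel_probs (X \<times> Y) dZ \<Longrightarrow>
      bl_dist (X \<times> Y) dZ P Q < \<delta> \<Longrightarrow> f \<in> H \<Longrightarrow> norm_fun f \<le> lip * \<kappa> / reg \<Longrightarrow>
      \<bar>shifted_risk L P f - shifted_risk L Q f\<bar> < reg * e\<^sup>2 / 2"
    by (rule shifted_risk_uniformly_continuous) blast
  have "ip_dist X H ip (svm L H ip reg P) (svm L H ip reg Q) < e"
    if P: "P \<in> borel_probs (X \<times> Y) dZ" and Q: "Q \<in> borel_probs (X \<times> Y) dZ"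
      and PQ: "bl_dist (X \<times> Y) dZ P Q < \<delta>" for P Q
  proof (rule power_less_imp_less_base[of _ 2])
    have "reg * (ip_dist X H ip (svm L H ip reg P) (svm L H ip reg Q))\<^sup>2 < reg * e\<^sup>2"
      using svm_dist_power2_le[OF P Q]
        \<delta>(2)[OF P Q PQ svm_minimizes(1)[OF P] norm_svm_le[OF P]]
        \<delta>(2)[OF P Q PQ svm_minimizes(1)[OF Q] norm_svm_le[OF Q]]
      by linarith
    then show "(ip_dist X H ip (svm L H ip reg P) (svm L H ip reg Q))\<^sup>2 < e\<^sup>2"
      using reg_pos by simp
  qed (use e in simp)
  then show ?thesis using \<delta>(1) by blast
qed

text \<open>The intermediate value is the risk under \<open>Q\<close> of the solution for
  \<open>P\<close>: the first step changes the measure under a fixed function of bounded norm, the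
  second changes the function under a fixed measure.\<close>

lemma svm_risk_uniformly_continuous:
  assumes e: "0 < e"
  shows "\<exists>\<delta>>0. \<forall>P\<in>borel_probs (X \<times> Y) dZ. \<forall>Q\<in>borel_probs (X \<times> Y) dZ. bl_dist (X \<times> Y) dZ P Q < \<delta> \<longrightarrow>
    dist (svm_risk L H ip reg P) (svm_risk L H ip reg Q) < e"
proof -
  have e2: "e / 2 > 0" using e by simp
  have R: "0 \<le> lip * \<kappa> / reg" using lip_pos reg_pos kappa_nonneg by simp
  obtain \<delta>1 where \<delta>1: "\<delta>1 > 0"
    "\<And>P Q f. P \<in> borel_probs (X \<times> Y) dZ \<Longrightarrow> Q \<in> borel_probs (X \<times> Y) dZ \<Longrightarrow>
      bl_dist (X \<times> Y) dZ P Q < \<delta>1 \<Longrightarrow> f \<in> H \<Longrightarrow> norm_fun f \<le> lip * \<kappa> / reg \<Longrightarrow>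
      \<bar>shifted_risk L P f - shifted_risk L Q f\<bar> < e / 2"
    using e2 R by (rule shifted_risk_uniformly_continuous) blast
  \<comment> \<open>The added 1 makes \<open>c\<close> positive from \<open>0 \<le> \<kappa>\<close>
    alone, so that \<open>e / 2 / c\<close> is a legitimate tolerance.\<close>
  define c where "c = lip * \<kappa> + 1"
  have c: "c > 0" using lip_pos kappa_nonneg by (simp add: c_def add_nonneg_pos)
  then have "e / 2 / c > 0" using e by simp
  from svm_uniformly_continuous[OF this] obtain \<delta>2 where \<delta>2: "\<delta>2 > 0"
    "\<And>P Q. P \<in> borel_probs (X \<times> Y) dZ \<Longrightarrow> Q \<in> borel_probs (X \<times> Y) dZ \<Longrightarrow>
      bl_dist (X \<times> Y) dZ P Q < \<delta>2 \<Longrightarrow> ip_dist X H ip (svm L H ip reg P) (svm L H ip reg Q) < e / 2 / c"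
    by blast
  have "dist (svm_risk L H ip reg P) (svm_risk L H ip reg Q) < e"
    if P: "P \<in> borel_probs (X \<times> Y) dZ" and Q: "Q \<in> borel_probs (X \<times> Y) dZ"
      and PQ: "bl_dist (X \<times> Y) dZ P Q < min \<delta>1 \<delta>2" for P Q
  proof -
    let ?f = "svm L H ip reg P" and ?g = "svm L H ip reg Q"
    note f = svm_minimizes(1)[OF P] and g = svm_minimizes(1)[OF Q]
    have "\<bar>shifted_risk L P ?f - shifted_risk L Q ?f\<bar> < e / 2"
      using \<delta>1(2)[OF P Q _ f norm_svm_le[OF P]] PQ by simp
    moreover have "\<bar>shifted_risk L Q ?f - shifted_risk L Q ?g\<bar> \<le> lip * \<kappa> * ip_dist X H ip ?f ?g"
      by (rule shifted_risk_lipschitz[OF Q f g])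
    moreover have "lip * \<kappa> * ip_dist X H ip ?f ?g \<le> c * ip_dist X H ip ?f ?g"
      by (intro mult_right_mono) (auto simp: c_def)
    moreover have "c * ip_dist X H ip ?f ?g < e / 2"
      using \<delta>2(2)[OF P Q] PQ c by (simp add: less_divide_eq mult.commute)
    ultimately show ?thesis unfolding svm_risk_def dist_real_def by linarith
  qed
  moreover have "min \<delta>1 \<delta>2 > 0" using \<delta>1 \<delta>2 by simp
  ultimately show ?thesis by blast
qed

section \<open>Robustness of both bootstrap sequences\<close>

lemma mtotally_bounded_Z: "Z.mtotally_bounded (X \<times> Y)"
  using compact_space_Z by (intro Z.compactin_imp_mtotally_bounded) (simp add: compact_space_def)

lemma bootstrap_svm_robust:
  assumes P: "P \<in> borel_probs (X \<times> Y) dZ"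
  shows "bootstrap_qualitatively_robust_at (X \<times> Y) dZ H (ip_dist X H ip) (svm L H ip reg) P"
proof -
  interpret two_metrics "X \<times> Y" dZ H "ip_dist X H ip"
    by unfold_locales (rule mtotally_bounded_Z)
  show ?thesis
    by (rule bootstrap_qualitatively_robust_atI[OF svm_minimizes(1) svm_uniformly_continuous P])
qed

lemma bootstrap_svm_risk_robust:
  assumes P: "P \<in> borel_probs (X \<times> Y) dZ"
  shows "bootstrap_qualitatively_robust_at (X \<times> Y) dZ UNIV dist (svm_risk L H ip reg) P"
proof -
  interpret two_metrics "X \<times> Y" dZ "UNIV :: real set" dist
    by (intro two_metrics.intro two_metrics_axioms.intro Met_TC.Metric_space_axioms
        Z.Metric_space_axioms mtotally_bounded_Z)
  show ?thesis
    by (rule bootstrap_qualitatively_robust_atI[OF _ svm_risk_uniformly_continuous P]) simp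
qed

end

theorem theorem8:
  fixes X :: "'x::topological_space set"
    and Y :: "real set"
    and dZ :: "'x \<times> real \<Rightarrow> 'x \<times> real \<Rightarrow> real"
    and L :: "'x \<Rightarrow> real \<Rightarrow> real \<Rightarrow> real"
    and lip :: real
    and k :: "'x \<Rightarrow> 'x \<Rightarrow> real"
    and H :: "('x \<Rightarrow> real) set"
    and ip :: "('x \<Rightarrow> real) \<Rightarrow> ('x \<Rightarrow> real) \<Rightarrow> real"
    and reg :: real
  assumes Y_closed: "closed Y"
    and Z_metric: "Metric_space (X \<times> Y) dZ"
    and Z_topology: "Metric_space.mtopology (X \<times> Y) dZ = top_of_set (X \<times> Y)"
    and Z_compact: "compact (X \<times> Y)"
    and L_nonneg: "\<And>x y t. x \<in> X \<Longrightarrow> y \<in> Y \<Longrightarrow> 0 \<le> L x y t"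
    and L_continuous: "continuous_on (X \<times> Y \<times> UNIV) (\<lambda>(x, y, t). L x y t)"
    and L_convex: "\<And>x y. x \<in> X \<Longrightarrow> y \<in> Y \<Longrightarrow> convex_on UNIV (L x y)"
    and L_lipschitz: "is_uniform_lipschitz_const X Y L lip"
    and lip_pos: "0 < lip"
    and k_kernel: "is_kernel X k"
    and k_continuous: "continuous_on (X \<times> X) (\<lambda>(x, x'). k x x')"
    and H_rkhs: "is_rkhs X k H ip"
    and k_bounded: "bdd_above ((\<lambda>x. k x x) ` X)"
    and k_norm_pos: "0 < sqrt (SUP x\<in>X. k x x)"
    and reg_pos: "0 < reg"
  shows "(\<forall>P\<in>borel_probs (X \<times> Y) dZ.
            bootstrap_qualitatively_robust_at (X \<times> Y) dZ H (ip_dist X H ip) (svm L H ip reg) P) \<and>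
         (\<forall>P\<in>borel_probs (X \<times> Y) dZ.
            bootstrap_qualitatively_robust_at (X \<times> Y) dZ UNIV dist (svm_risk L H ip reg) P)"
proof -
  have lip: "lip-lipschitz_on UNIV (L x y)" if "x \<in> X" "y \<in> Y" for x y
    using L_lipschitz that by (simp add: is_uniform_lipschitz_const_def)
  have rkhs: "hilbert_function_space X H ip" "\<And>x. x \<in> X \<Longrightarrow> (\<lambda>u\<in>X. k u x) \<in> H"
    "\<And>x f. x \<in> X \<Longrightarrow> f \<in> H \<Longrightarrow> f x = ip f (\<lambda>u\<in>X. k u x)"
    using H_rkhs unfolding is_rkhs_def by blast+
  interpret svm_setting X Y dZ H ip L lip k reg
    by (intro svm_setting.intro function_hilbert_space.intro svm_setting_axioms.intro
        Z_metric Z_topology Z_compact L_continuous L_convex lip lip_pos k_continuous rkhs k_bounded reg_pos)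
  show ?thesis
    using bootstrap_svm_robust bootstrap_svm_risk_robust by blast
qed

end
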